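(* Let $Y_t=f(t,X_t)$, $t\in[0,T]$, where $X$ is a Gaussian process satisfying the standing assumption (A) of the context and the measurable mapping $f:[0,T]\times\mathbb{R}\to\mathbb{R}$ is such that $x\mapsto f(t,x)$ is bijective for all $t\in[0,T]$. Let $\Delta=[t_L^1,t_U^1]\cup\dots\cup[t_L^n,t_U^n]$ with $0\le t_L^1<t_U^1<t_L^2<\dots<t_L^n<t_U^n\le T$, and let $\mathcal{F}^Y_\Delta=\sigma(Y_t:t\in\Delta)$. Then for any $t\in[0,T]\setminus\Delta$ we have $$\mathbb{E}[Y_t\mid\mathcal{F}^Y_\Delta]=\int_{-\infty}^\infty f\big(t,\hat X_t+z\sqrt{\rho(t,t|\Delta)}\big)\phi(z)\,dz,$$ where $\phi$ is the standard normal density, $\hat X_t=\mathbb{E}[X_t\mid\mathcal{F}_\Delta]=\int_0^Tf_t(s)\,dW_s$ and $\rho(t,t|\Delta)=\int_0^T[K(t,u)-f_t(u)]^2\,du$, with $f_t$ as described in the context.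
   Context: Standing assumption (A): $T>0$; $X=(X_t)_{t\in[0,T]}$ is a centered and separable Gaussian process with $\sup_{t\in[0,T]}\mathbb{E}[X_t^2]<\infty$; there exist a deterministic kernel $K\in L^2([0,T]^2)$ and a standard Brownian motion $W$ such that $X_t=\int_0^T K(t,s)\,dW_s$ (Wiener integral) holds exactly, not only in law; and $H^X_T=H^W_T$. Here, for a process $Z$, $H^Z_t$ denotes the closure in $L^2(\Omega)$ of the linear span of $\{Z_s:s\in[0,t]\}$. $\mathcal{F}_\Delta=\sigma(X_t:t\in\Delta)$. The function $f_t\in L^2([0,T])$ is the solution of the system of Fredholm integral equations $$\int_0^Tf_t(s)K(u_k,s)\,ds=\int_0^TK(t,s)K(u_k,s)\,ds,\qquad k=1,\dots,n,\ \text{ for all } t_L^k\le u_k<t_U^k,$$ that satisfies $\int_0^Tf_t(s)g(s)\,ds=0$ for all $g\in L^2([0,T])$ such that $\int_0^Tg(s)K(u_k,s)\,ds=0$ (for all such $k$ and $u_k$). It is the unique solution of the system for which $\mathbb{E}[X_t\mid\mathcal{F}_\Delta]=\int_0^Tf_t(s)\,dW_s$. *)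

theory Defs
  imports "HOL-Probability.Probability"
begin

text \<open>
  Elements of \<open>L\<^sup>2\<close> are represented by functions rather than by equivalence classes.
  The space \<open>L\<^sup>2([0,T])\<close> is \<open>L2 (lebesgue_on {0..T})\<close>, and \<open>L\<^sup>2(\<Omega>)\<close> is \<open>L2 M\<close>.
\<close>

definition L2 :: "'a measure \<Rightarrow> ('a \<Rightarrow> real) set" where
  "L2 N = {f \<in> borel_measurable N. integrable N (\<lambda>x. (f x)\<^sup>2)}"

definition sigma_gen :: "'a measure \<Rightarrow> (real \<Rightarrow> 'a \<Rightarrow> real) \<Rightarrow> real set \<Rightarrow> 'a measure" where
  "sigma_gen M Z D = sigma (space M) {Z t -` B \<inter> space M | t B. t \<in> D \<and> B \<in> sets borel}"

text \<open>
  The linear space \<open>H\<^sup>Z\<^sub>t\<close>. It is closed under modification on null sets, so equality of two such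
  sets of functions is equality of the corresponding subspaces of \<open>L\<^sup>2(\<Omega>)\<close>.
\<close>

definition lin_space :: "'a measure \<Rightarrow> (real \<Rightarrow> 'a \<Rightarrow> real) \<Rightarrow> real \<Rightarrow> ('a \<Rightarrow> real) set" where
  "lin_space M Z t = {U \<in> L2 M. \<forall>e>0. \<exists>S c. finite S \<and> S \<subseteq> {0..t} \<and>
     (\<integral>\<omega>. (U \<omega> - (\<Sum>s\<in>S. c s * Z s \<omega>))\<^sup>2 \<partial>M) < e}"

text \<open>
  Separability is that of the Hilbert space \<open>L\<^sup>2(\<Omega>, \<sigma>(Z), P)\<close>, as is usual for Fredholm
  representations of Gaussian processes; it is not Doob's separability of the paths.
\<close>

definition separable_process :: "'a measure \<Rightarrow> real \<Rightarrow> (real \<Rightarrow> 'a \<Rightarrow> real) \<Rightarrow> bool" where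
  "separable_process M T Z \<longleftrightarrow>
     (let H = L2 (restr_to_subalg M (sigma_gen M Z {0..T})) in
      \<exists>D. countable D \<and> D \<subseteq> H \<and> (\<forall>U\<in>H. \<forall>e>0. \<exists>V\<in>D. (\<integral>\<omega>. (U \<omega> - V \<omega>)\<^sup>2 \<partial>M) < e))"

text \<open>Degenerate normal laws, i.e. constants, are included.\<close>

definition gaussian_rv :: "'a measure \<Rightarrow> ('a \<Rightarrow> real) \<Rightarrow> bool" where
  "gaussian_rv M U \<longleftrightarrow> U \<in> borel_measurable M \<and>
     (\<exists>\<mu>. (AE \<omega> in M. U \<omega> = \<mu>) \<or>
          (\<exists>\<sigma>>0. distributed M lborel U (\<lambda>x. ennreal (normal_density \<mu> \<sigma> x))))"

definition gaussian_process :: "'a measure \<Rightarrow> real \<Rightarrow> (real \<Rightarrow> 'a \<Rightarrow> real) \<Rightarrow> bool" where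
  "gaussian_process M T Z \<longleftrightarrow>
     (\<forall>S c. finite S \<and> S \<subseteq> {0..T} \<longrightarrow> gaussian_rv M (\<lambda>\<omega>. \<Sum>s\<in>S. c s * Z s \<omega>))"

definition (in prob_space) brownian_motion :: "real \<Rightarrow> (real \<Rightarrow> 'a \<Rightarrow> real) \<Rightarrow> bool" where
  "brownian_motion T W \<longleftrightarrow>
     (\<forall>t\<in>{0..T}. random_variable borel (W t)) \<and>
     (AE \<omega> in M. W 0 \<omega> = 0) \<and>
     (\<forall>s t. 0 \<le> s \<and> s < t \<and> t \<le> T \<longrightarrow>
        distributed M lborel (\<lambda>\<omega>. W t \<omega> - W s \<omega>)
          (\<lambda>x. ennreal (normal_density 0 (sqrt (t - s)) x))) \<and>
     (\<forall>(n::nat) t. (\<forall>i\<le>n. t i \<in> {0..T}) \<and> (\<forall>i<n. t i < t (Suc i)) \<longrightarrow>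
        indep_vars (\<lambda>_. borel) (\<lambda>i \<omega>. W (t (Suc i)) \<omega> - W (t i) \<omega>) {..<n}) \<and>
     (AE \<omega> in M. continuous_on {0..T} (\<lambda>t. W t \<omega>))"

text \<open>
  The list entry \<open>(c, a, b)\<close> stands for \<open>c\<close> times the indicator of \<open>(a, b]\<close>; the intervals in a
  list may overlap.
\<close>

definition step_fun :: "(real \<times> real \<times> real) list \<Rightarrow> real \<Rightarrow> real" where
  "step_fun p s = (\<Sum>(c, a, b)\<leftarrow>p. c * indicator {a<..b} s)"

definition step_integral ::
    "(real \<Rightarrow> 'a \<Rightarrow> real) \<Rightarrow> (real \<times> real \<times> real) list \<Rightarrow> 'a \<Rightarrow> real" where
  "step_integral W p \<omega> = (\<Sum>(c, a, b)\<leftarrow>p. c * (W b \<omega> - W a \<omega>))"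

text \<open>
  \<open>has_wiener_integral M T W f I\<close> says that \<open>I\<close> is a version of the Wiener integral of \<open>f\<close> over
  \<open>[0,T]\<close>: the \<open>L\<^sup>2(\<Omega>)\<close>-limit of the integrals of step functions converging to \<open>f\<close> in
  \<open>L\<^sup>2([0,T])\<close>. By the Ito isometry \<open>I\<close> is determined up to null sets by \<open>f\<close> and does not depend
  on the approximating sequence.
\<close>

definition has_wiener_integral ::
    "'a measure \<Rightarrow> real \<Rightarrow> (real \<Rightarrow> 'a \<Rightarrow> real) \<Rightarrow> (real \<Rightarrow> real) \<Rightarrow> ('a \<Rightarrow> real) \<Rightarrow> bool" where
  "has_wiener_integral M T W f I \<longleftrightarrow>
     f \<in> L2 (lebesgue_on {0..T}) \<and> I \<in> L2 M \<and>
     (\<exists>p :: nat \<Rightarrow> (real \<times> real \<times> real) list.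
        (\<forall>m. \<forall>(c, a, b)\<in>set (p m). 0 \<le> a \<and> a \<le> b \<and> b \<le> T) \<and>
        (\<lambda>m. \<integral>s. (f s - step_fun (p m) s)\<^sup>2 \<partial>lebesgue_on {0..T}) \<longlonglongrightarrow> 0 \<and>
        (\<lambda>m. \<integral>\<omega>. (I \<omega> - step_integral W (p m) \<omega>)\<^sup>2 \<partial>M) \<longlonglongrightarrow> 0)"

locale fredholm_gaussian_process = prob_space M for M :: "'a measure" +
  fixes T :: real
    and X :: "real \<Rightarrow> 'a \<Rightarrow> real"
    and K :: "real \<Rightarrow> real \<Rightarrow> real"
    and W :: "real \<Rightarrow> 'a \<Rightarrow> real"
  assumes T_pos: "T > 0"
    and gaussian: "gaussian_process M T X"
    and centered: "\<forall>t\<in>{0..T}. expectation (X t) = 0"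
    and separable: "separable_process M T X"
    and bounded_variance: "bdd_above ((\<lambda>t. expectation (\<lambda>\<omega>. (X t \<omega>)\<^sup>2)) ` {0..T})"
    and kernel_L2: "(\<lambda>(t, s). K t s) \<in> L2 (lebesgue_on ({0..T} \<times> {0..T}))"
    and brownian: "brownian_motion T W"
    and fredholm: "\<forall>t\<in>{0..T}. has_wiener_integral M T W (K t) (X t)"
    and lin_space_eq: "lin_space M X T = lin_space M W T"

definition interval_system :: "real \<Rightarrow> nat \<Rightarrow> (nat \<Rightarrow> real) \<Rightarrow> (nat \<Rightarrow> real) \<Rightarrow> bool" where
  "interval_system T n tL tU \<longleftrightarrow> 1 \<le> n \<and> 0 \<le> tL 1 \<and> tU n \<le> T \<and>
     (\<forall>k\<in>{1..n}. tL k < tU k) \<and> (\<forall>k\<in>{1..<n}. tU k < tL (Suc k))"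

definition observed :: "nat \<Rightarrow> (nat \<Rightarrow> real) \<Rightarrow> (nat \<Rightarrow> real) \<Rightarrow> real set" where
  "observed n tL tU = (\<Union>k\<in>{1..n}. {tL k..tU k})"

text \<open>
  \<open>prediction_kernel M T X K W n tL tU t ft\<close> says that \<open>ft\<close> is the kernel \<open>f\<^sub>t\<close>. The system and the
  orthogonality condition only involve \<open>u < tU k\<close>, whereas the conditioning uses the closed
  intervals, and \<open>X\<close> need not be mean-square left-continuous at \<open>tU k\<close>. Hence the last clause,
  which is part of the description of \<open>f\<^sub>t\<close>, does not follow from the others in general. An example
  is \<open>X u = W u\<close> for \<open>u \<noteq> 1/2\<close> and \<open>X (1/2) = W 1\<close>, observed on \<open>[0, 1/2]\<close>.
\<close>

definition prediction_kernel ::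
    "'a measure \<Rightarrow> real \<Rightarrow> (real \<Rightarrow> 'a \<Rightarrow> real) \<Rightarrow> (real \<Rightarrow> real \<Rightarrow> real) \<Rightarrow> (real \<Rightarrow> 'a \<Rightarrow> real)
      \<Rightarrow> nat \<Rightarrow> (nat \<Rightarrow> real) \<Rightarrow> (nat \<Rightarrow> real) \<Rightarrow> real \<Rightarrow> (real \<Rightarrow> real) \<Rightarrow> bool" where
  "prediction_kernel M T X K W n tL tU t ft \<longleftrightarrow>
     ft \<in> L2 (lebesgue_on {0..T}) \<and>
     (\<forall>k\<in>{1..n}. \<forall>u\<in>{tL k..<tU k}.
        (\<integral>s. ft s * K u s \<partial>lebesgue_on {0..T}) = (\<integral>s. K t s * K u s \<partial>lebesgue_on {0..T})) \<and>
     (\<forall>g\<in>L2 (lebesgue_on {0..T}).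
        (\<forall>k\<in>{1..n}. \<forall>u\<in>{tL k..<tU k}. (\<integral>s. g s * K u s \<partial>lebesgue_on {0..T}) = 0) \<longrightarrow>
        (\<integral>s. ft s * g s \<partial>lebesgue_on {0..T}) = 0) \<and>
     has_wiener_integral M T W ft (real_cond_exp M (sigma_gen M X (observed n tL tU)) (X t))"

end

theory Submission
  imports Defs
begin

text \<open>
  Put \<open>R = X\<^sub>t - E[X\<^sub>t | F\<^sub>\<Delta>]\<close>. Both terms are Wiener integrals, so \<open>R\<close> lies in the linear space of \<open>W\<close>,
  which is that of \<open>X\<close>. Elements of the latter are \<open>L\<^sup>2\<close>-limits of centered Gaussian variables, hence
  jointly Gaussian, and \<open>E R\<^sup>2 = \<rho>\<close> by the Ito isometry. As \<open>R\<close> is uncorrelated with each \<open>X\<^sub>s\<close>, \<open>s \<in> \<Delta>\<close>, it is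
  independent of \<open>F\<^sub>\<Delta>\<close>, and Fubini's theorem yields the formula with \<open>F\<^sub>\<Delta>\<close> in place of \<open>F\<^sup>Y\<^sub>\<Delta>\<close>. By
  injectivity of the maps \<open>x \<mapsto> f(s, x)\<close> the two sigma algebras agree up to null sets.
\<close>

section \<open>The space of square-integrable functions\<close>

text \<open>Joint Gaussianity is never expressed by a multivariate law. A conditional expectation
  carries no distributional information by itself; once it is known to be a Wiener integral, the
  equality of the two linear spaces makes every combination of the residual with observed values an
  L2-limit of combinations of the \<open>X s\<close>, and its scalar characteristic function is then
  explicit. The factorisation of these functions has to become independence from a sigma algebra
  generated by uncountably many variables. The scalar uniqueness theorem suffices for this:
  exponentials are replaced by indicators one variable at a time, and a Dynkin argument passes from
  cylinders to the sigma algebra. Two further points shape the statements. The number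
  \<open>\<rho>\<close> may be 0, so the law of the residual is treated as a scaled image of the
  standard normal law and not through a density. The inverses of the maps x -> f(s,x) are not shown
  to be Borel; events are matched only up to null sets, which conditional expectations do not
  see.\<close>

lemma L2_I: "f \<in> borel_measurable N \<Longrightarrow> integrable N (\<lambda>x. (f x)\<^sup>2) \<Longrightarrow> f \<in> L2 N"
  by (simp add: L2_def)

lemma L2_measurable: "f \<in> L2 N \<Longrightarrow> f \<in> borel_measurable N"
  by (simp add: L2_def)

lemma L2_integrable_square: "f \<in> L2 N \<Longrightarrow> integrable N (\<lambda>x. (f x)\<^sup>2)"
  by (simp add: L2_def)

lemma L2_integrable_mult:
  assumes "f \<in> L2 N" "g \<in> L2 N"
  shows "integrable N (\<lambda>x. f x * g x)"
proof (rule Bochner_Integration.integrable_bound)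
  show "integrable N (\<lambda>x. (f x)\<^sup>2 + (g x)\<^sup>2)"
    using L2_integrable_square[OF assms(1)] L2_integrable_square[OF assms(2)] by simp
  show "(\<lambda>x. f x * g x) \<in> borel_measurable N"
    using assms[THEN L2_measurable] by simp
  have "\<bar>a * b\<bar> \<le> a\<^sup>2 + b\<^sup>2" for a b :: real
  proof -
    have "\<bar>a * b\<bar> \<le> 2 * \<bar>a\<bar> * \<bar>b\<bar>" by (simp add: abs_mult)
    also have "\<dots> \<le> a\<^sup>2 + b\<^sup>2" using sum_squares_bound[of "\<bar>a\<bar>" "\<bar>b\<bar>"] by simp
    finally show ?thesis .
  qed
  then show "AE x in N. norm (f x * g x) \<le> norm ((f x)\<^sup>2 + (g x)\<^sup>2)"
    by (intro AE_I2) (simp add: )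
qed

lemma L2_lincomb:
  assumes "f \<in> L2 N" "g \<in> L2 N"
  shows "(\<lambda>x. a * f x + b * g x) \<in> L2 N"
proof (rule L2_I)
  show "(\<lambda>x. a * f x + b * g x) \<in> borel_measurable N"
    using assms[THEN L2_measurable] by simp
  have "(\<lambda>x. (a * f x + b * g x)\<^sup>2) =
      (\<lambda>x. a\<^sup>2 * (f x)\<^sup>2 + b\<^sup>2 * (g x)\<^sup>2 + 2 * a * b * (f x * g x))"
    by (simp add: power2_eq_square algebra_simps)
  then show "integrable N (\<lambda>x. (a * f x + b * g x)\<^sup>2)"
    using L2_integrable_square[OF assms(1)] L2_integrable_square[OF assms(2)]
      L2_integrable_mult[OF assms] by simp
qed

lemma L2_zero: "(\<lambda>x. 0) \<in> L2 N"
  by (simp add: L2_def)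

lemma L2_add: "f \<in> L2 N \<Longrightarrow> g \<in> L2 N \<Longrightarrow> (\<lambda>x. f x + g x) \<in> L2 N"
  using L2_lincomb[of f N g 1 1] by simp

lemma L2_diff: "f \<in> L2 N \<Longrightarrow> g \<in> L2 N \<Longrightarrow> (\<lambda>x. f x - g x) \<in> L2 N"
  using L2_lincomb[of f N g 1 "-1"] by simp

lemma L2_cmult: "f \<in> L2 N \<Longrightarrow> (\<lambda>x. c * f x) \<in> L2 N"
  using L2_lincomb[of f N f c 0] by simp

lemma L2_sum: "(\<And>i. i \<in> S \<Longrightarrow> f i \<in> L2 N) \<Longrightarrow> (\<lambda>x. \<Sum>i\<in>S. f i x) \<in> L2 N"
  by (induction S rule: infinite_finite_induct) (auto intro: L2_zero L2_add)

text \<open>The quadratic r -> integral of (f + r g)^2 is nonnegative, and at its minimum r = -B/C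
  it equals A - B^2/C. For C = 0 there is no such minimum, and the polynomial is affine.\<close>

lemma L2_Cauchy_Schwarz:
  assumes "f \<in> L2 N" "g \<in> L2 N"
  shows "(\<integral>x. f x * g x \<partial>N)\<^sup>2 \<le> (\<integral>x. (f x)\<^sup>2 \<partial>N) * (\<integral>x. (g x)\<^sup>2 \<partial>N)"
proof -
  define A B C where "A = (\<integral>x. (f x)\<^sup>2 \<partial>N)" and "B = (\<integral>x. f x * g x \<partial>N)"
    and "C = (\<integral>x. (g x)\<^sup>2 \<partial>N)"
  have quad: "0 \<le> A + 2 * r * B + r\<^sup>2 * C" for r
  proof -
    have "0 \<le> (\<integral>x. (f x + r * g x)\<^sup>2 \<partial>N)" by simp
    also have "(\<lambda>x. (f x + r * g x)\<^sup>2) = (\<lambda>x. (f x)\<^sup>2 + 2 * r * (f x * g x) + r\<^sup>2 * (g x)\<^sup>2)"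
      by (simp add: power2_eq_square algebra_simps)
    also have "(\<integral>x. (f x)\<^sup>2 + 2 * r * (f x * g x) + r\<^sup>2 * (g x)\<^sup>2 \<partial>N) = A + 2 * r * B + r\<^sup>2 * C"
      using L2_integrable_square[OF assms(1)] L2_integrable_square[OF assms(2)]
        L2_integrable_mult[OF assms] by (simp add: A_def B_def C_def)
    finally show ?thesis .
  qed
  have "C \<ge> 0" "A \<ge> 0" by (simp_all add: C_def A_def)
  have "B\<^sup>2 \<le> A * C"
  proof (cases "C = 0")
    case True
    have "B = 0"
    proof (rule ccontr)
      assume "B \<noteq> 0"
      \<comment> \<open>At r = -(A+1)/(2B) the affine function A + 2 r B would take the value
        -1.\<close>
      then have "2 * (- (A + 1) / (2 * B)) * B = - (A + 1)" by simp
      then show False using quad[of "- (A + 1) / (2 * B)"] True by simp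
    qed
    then show ?thesis using True by simp
  next
    case False
    then have "A + 2 * (- B / C) * B + (- B / C)\<^sup>2 * C = A - B\<^sup>2 / C"
      by (simp add: power2_eq_square field_simps)
    then have "B\<^sup>2 / C \<le> A" using quad[of "- B / C"] by simp
    then show ?thesis using False \<open>C \<ge> 0\<close> by (simp add: divide_le_eq)
  qed
  then show ?thesis by (simp add: A_def B_def C_def)
qed

text \<open>The square of \<open>g m\<close> is that of f plus that of f - \<open>g m\<close> minus
  twice f times f - \<open>g m\<close>; Cauchy-Schwarz makes the mixed term small. The lemma moves
  variances to the limit, both in Gaussian characteristic functions and in the Ito isometry.\<close>

lemma L2_tendsto_integral_square:
  assumes f: "f \<in> L2 N" and g: "\<And>m :: nat. g m \<in> L2 N"
    and lim: "(\<lambda>m. \<integral>x. (f x - g m x)\<^sup>2 \<partial>N) \<longlonglongrightarrow> 0"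
  shows "(\<lambda>m. \<integral>x. (g m x)\<^sup>2 \<partial>N) \<longlonglongrightarrow> (\<integral>x. (f x)\<^sup>2 \<partial>N)"
proof -
  define d where "d m = (\<integral>x. (f x - g m x)\<^sup>2 \<partial>N)" for m
  have dL: "(\<lambda>x. f x - g m x) \<in> L2 N" for m using f g by (rule L2_diff)
  have eq: "(\<integral>x. (g m x)\<^sup>2 \<partial>N) =
      (\<integral>x. (f x)\<^sup>2 \<partial>N) + d m - 2 * (\<integral>x. f x * (f x - g m x) \<partial>N)" for m
  proof -
    have "(\<lambda>x. (g m x)\<^sup>2) = (\<lambda>x. (f x)\<^sup>2 + (f x - g m x)\<^sup>2 - 2 * (f x * (f x - g m x)))"
      by (simp add: power2_eq_square algebra_simps)
    then show ?thesis
      using L2_integrable_square[OF f] L2_integrable_square[OF dL[of m]]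
        L2_integrable_mult[OF f dL[of m]]
      by (simp add: d_def)
  qed
  have "(\<lambda>m. \<integral>x. f x * (f x - g m x) \<partial>N) \<longlonglongrightarrow> 0"
  proof (rule Lim_null_comparison)
    show "(\<lambda>m. sqrt ((\<integral>x. (f x)\<^sup>2 \<partial>N) * d m)) \<longlonglongrightarrow> 0"
      using tendsto_real_sqrt[OF tendsto_mult_left[OF lim, of "\<integral>x. (f x)\<^sup>2 \<partial>N"]]
      by (simp add: d_def)
    show "\<forall>\<^sub>F m in sequentially. norm (\<integral>x. f x * (f x - g m x) \<partial>N)
        \<le> sqrt ((\<integral>x. (f x)\<^sup>2 \<partial>N) * d m)"
    proof (intro always_eventually allI)
      show "norm (\<integral>x. f x * (f x - g m x) \<partial>N) \<le> sqrt ((\<integral>x. (f x)\<^sup>2 \<partial>N) * d m)" for m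
        using real_sqrt_le_mono[OF L2_Cauchy_Schwarz[OF f dL[of m]]] by (simp add: d_def)
    qed
  qed
  from tendsto_diff[OF tendsto_add[OF tendsto_const lim] tendsto_mult_left[OF this]]
  show ?thesis unfolding eq d_def by simp
qed

lemma (in prob_space) L2_integrable: "U \<in> L2 M \<Longrightarrow> integrable M U"
  using L2_integrable_mult[of U M "\<lambda>_. 1"] by (simp add: L2_def)

lemma (in prob_space) L2_expectation_abs_le:
  assumes "U \<in> L2 M"
  shows "expectation (\<lambda>\<omega>. \<bar>U \<omega>\<bar>) \<le> sqrt (expectation (\<lambda>\<omega>. (U \<omega>)\<^sup>2))"
proof (rule real_le_rsqrt)
  have "(\<lambda>\<omega>. \<bar>U \<omega>\<bar>) \<in> L2 M" "(\<lambda>\<omega>. 1) \<in> L2 M" using assms by (auto simp: L2_def)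
  from L2_Cauchy_Schwarz[OF this]
  show "(expectation (\<lambda>\<omega>. \<bar>U \<omega>\<bar>))\<^sup>2 \<le> expectation (\<lambda>\<omega>. (U \<omega>)\<^sup>2)"
    by (simp add: prob_space)
qed

section \<open>The linear space of a process\<close>

lemma lin_space_base:
  assumes "Z s \<in> L2 M" "s \<in> {0..t}"
  shows "Z s \<in> lin_space M Z t"
  unfolding lin_space_def
proof (intro CollectI conjI allI impI)
  fix e :: real assume "e > 0"
  then show "\<exists>S c. finite S \<and> S \<subseteq> {0..t} \<and>
      (\<integral>\<omega>. (Z s \<omega> - (\<Sum>r\<in>S. c r * Z r \<omega>))\<^sup>2 \<partial>M) < e"
    using assms(2) by (intro exI[of _ "{s}"] exI[of _ "\<lambda>_. 1"]) simp
qed (rule assms)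

lemma lin_space_lincomb:
  assumes Z: "\<And>s. s \<in> {0..t} \<Longrightarrow> Z s \<in> L2 M"
    and U: "U \<in> lin_space M Z t" and V: "V \<in> lin_space M Z t"
  shows "(\<lambda>\<omega>. a * U \<omega> + b * V \<omega>) \<in> lin_space M Z t"
  unfolding lin_space_def
proof (intro CollectI conjI allI impI)
  have UL: "U \<in> L2 M" and VL: "V \<in> L2 M" using U V by (auto simp: lin_space_def)
  show "(\<lambda>\<omega>. a * U \<omega> + b * V \<omega>) \<in> L2 M" using UL VL by (rule L2_lincomb)
  fix e :: real assume "e > 0"
  \<comment> \<open>By (x + y)^2 <= 2 x^2 + 2 y^2 errors are amplified at most by the factor q.
    Dividing by q + 1 keeps the final bound strict and covers a = b = 0.\<close>
  define q where "q = 2 * a\<^sup>2 + 2 * b\<^sup>2"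
  define \<delta> where "\<delta> = e / (q + 1)"
  have "q \<ge> 0" by (simp add: q_def)
  then have "\<delta> > 0" using \<open>e > 0\<close> by (simp add: \<delta>_def)
  from U \<open>\<delta> > 0\<close> obtain S c where S: "finite S" "S \<subseteq> {0..t}"
    "(\<integral>\<omega>. (U \<omega> - (\<Sum>s\<in>S. c s * Z s \<omega>))\<^sup>2 \<partial>M) < \<delta>" unfolding lin_space_def by blast
  from V \<open>\<delta> > 0\<close> obtain S' c' where S': "finite S'" "S' \<subseteq> {0..t}"
    "(\<integral>\<omega>. (V \<omega> - (\<Sum>s\<in>S'. c' s * Z s \<omega>))\<^sup>2 \<partial>M) < \<delta>" unfolding lin_space_def by blast
  \<comment> \<open>The two index sets may overlap, so both families of coefficients are extended by
    zero and added on the union.\<close>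
  define k where "k s = a * (if s \<in> S then c s else 0) + b * (if s \<in> S' then c' s else 0)" for s
  define D where "D \<omega> = U \<omega> - (\<Sum>s\<in>S. c s * Z s \<omega>)" for \<omega>
  define D' where "D' \<omega> = V \<omega> - (\<Sum>s\<in>S'. c' s * Z s \<omega>)" for \<omega>
  have DL: "D \<in> L2 M" unfolding D_def
    using UL S(2) by (intro L2_diff L2_sum L2_cmult Z) auto
  have DL': "D' \<in> L2 M" unfolding D'_def
    using VL S'(2) by (intro L2_diff L2_sum L2_cmult Z) auto
  have "(\<Sum>s\<in>S \<union> S'. k s * Z s \<omega>) =
      a * (\<Sum>s\<in>S. c s * Z s \<omega>) + b * (\<Sum>s\<in>S'. c' s * Z s \<omega>)" for \<omega>
  proof -
    have "(\<Sum>s\<in>S. c s * Z s \<omega>) = (\<Sum>s\<in>S \<union> S'. (if s \<in> S then c s else 0) * Z s \<omega>)"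
      using S(1) S'(1) by (intro sum.mono_neutral_cong_left) auto
    moreover have "(\<Sum>s\<in>S'. c' s * Z s \<omega>) = (\<Sum>s\<in>S \<union> S'. (if s \<in> S' then c' s else 0) * Z s \<omega>)"
      using S(1) S'(1) by (intro sum.mono_neutral_cong_left) auto
    ultimately show ?thesis
      by (simp add: k_def sum_distrib_left sum.distrib[symmetric] algebra_simps)
  qed
  then have eq: "a * U \<omega> + b * V \<omega> - (\<Sum>s\<in>S \<union> S'. k s * Z s \<omega>) = a * D \<omega> + b * D' \<omega>" for \<omega>
    by (simp add: D_def D'_def algebra_simps)
  have "(\<integral>\<omega>. (a * D \<omega> + b * D' \<omega>)\<^sup>2 \<partial>M)
      \<le> (\<integral>\<omega>. 2 * a\<^sup>2 * (D \<omega>)\<^sup>2 + 2 * b\<^sup>2 * (D' \<omega>)\<^sup>2 \<partial>M)"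
  proof (rule integral_mono)
    show "integrable M (\<lambda>\<omega>. (a * D \<omega> + b * D' \<omega>)\<^sup>2)"
      using L2_lincomb[OF DL DL'] by (rule L2_integrable_square)
    show "integrable M (\<lambda>\<omega>. 2 * a\<^sup>2 * (D \<omega>)\<^sup>2 + 2 * b\<^sup>2 * (D' \<omega>)\<^sup>2)"
      using L2_integrable_square[OF DL] L2_integrable_square[OF DL'] by simp
    fix \<omega>
    have "0 \<le> (a * D \<omega> - b * D' \<omega>)\<^sup>2" by simp
    then show "(a * D \<omega> + b * D' \<omega>)\<^sup>2 \<le> 2 * a\<^sup>2 * (D \<omega>)\<^sup>2 + 2 * b\<^sup>2 * (D' \<omega>)\<^sup>2"
      by (simp add: power2_eq_square algebra_simps)
  qed
  also have "\<dots> = 2 * a\<^sup>2 * (\<integral>\<omega>. (D \<omega>)\<^sup>2 \<partial>M) + 2 * b\<^sup>2 * (\<integral>\<omega>. (D' \<omega>)\<^sup>2 \<partial>M)"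
    using L2_integrable_square[OF DL] L2_integrable_square[OF DL'] by simp
  also have "\<dots> \<le> 2 * a\<^sup>2 * \<delta> + 2 * b\<^sup>2 * \<delta>"
    using S(3) S'(3) by (intro add_mono mult_left_mono) (auto simp: D_def D'_def)
  also have "\<dots> = e * (q / (q + 1))"
    by (simp add: \<delta>_def q_def add_divide_distrib algebra_simps)
  also have "\<dots> < e"
    using \<open>e > 0\<close> \<open>q \<ge> 0\<close> by (simp add: divide_less_eq mult_less_cancel_left1)
  finally have "(\<integral>\<omega>. (a * U \<omega> + b * V \<omega> - (\<Sum>s\<in>S \<union> S'. k s * Z s \<omega>))\<^sup>2 \<partial>M) < e"
    by (simp only: eq)
  then show "\<exists>S c. finite S \<and> S \<subseteq> {0..t} \<and>
      (\<integral>\<omega>. (a * U \<omega> + b * V \<omega> - (\<Sum>s\<in>S. c s * Z s \<omega>))\<^sup>2 \<partial>M) < e"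
    using S(1,2) S'(1,2) by (intro exI[of _ "S \<union> S'"] exI[of _ k]) simp
qed

lemma lin_space_zero: "(\<lambda>\<omega>. 0) \<in> lin_space M Z t"
  unfolding lin_space_def
proof (intro CollectI conjI allI impI)
  fix e :: real assume "e > 0"
  then show "\<exists>S c. finite S \<and> S \<subseteq> {0..t} \<and> (\<integral>\<omega>. (0 - (\<Sum>r\<in>S. c r * Z r \<omega>))\<^sup>2 \<partial>M) < e"
    by (intro exI[of _ "{}"]) simp
qed (rule L2_zero)

lemma lin_space_sum:
  assumes "\<And>s. s \<in> {0..t} \<Longrightarrow> Z s \<in> L2 M" and "\<And>i. i \<in> S \<Longrightarrow> U i \<in> lin_space M Z t"
  shows "(\<lambda>\<omega>. \<Sum>i\<in>S. c i * U i \<omega>) \<in> lin_space M Z t"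
  using assms(2)
proof (induction S rule: infinite_finite_induct)
  case (insert i S)
  then show ?case
    using lin_space_lincomb[where U = "U i" and V = "\<lambda>\<omega>. \<Sum>i\<in>S. c i * U i \<omega>" and
        a = "c i" and b = 1, OF assms(1)]
    by simp
qed (auto intro: lin_space_zero)

lemma lin_space_sequence:
  assumes "U \<in> lin_space M Z t"
  obtains S c where "\<And>m :: nat. finite (S m)" "\<And>m. S m \<subseteq> {0..t}"
    "(\<lambda>m. \<integral>\<omega>. (U \<omega> - (\<Sum>s\<in>S m. c m s * Z s \<omega>))\<^sup>2 \<partial>M) \<longlonglongrightarrow> 0"
proof -
  have "\<forall>m. \<exists>S c. finite S \<and> S \<subseteq> {0..t} \<and>
      (\<integral>\<omega>. (U \<omega> - (\<Sum>s\<in>S. c s * Z s \<omega>))\<^sup>2 \<partial>M) < inverse (real (Suc m))"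
    using assms by (simp add: lin_space_def)
  from choice[OF this] obtain S where "\<forall>m. \<exists>c. finite (S m) \<and> S m \<subseteq> {0..t} \<and>
      (\<integral>\<omega>. (U \<omega> - (\<Sum>s\<in>S m. c s * Z s \<omega>))\<^sup>2 \<partial>M) < inverse (real (Suc m))" ..
  from choice[OF this] obtain c where *: "\<forall>m. finite (S m) \<and> S m \<subseteq> {0..t} \<and>
      (\<integral>\<omega>. (U \<omega> - (\<Sum>s\<in>S m. c m s * Z s \<omega>))\<^sup>2 \<partial>M) < inverse (real (Suc m))" ..
  have "(\<lambda>m. \<integral>\<omega>. (U \<omega> - (\<Sum>s\<in>S m. c m s * Z s \<omega>))\<^sup>2 \<partial>M) \<longlonglongrightarrow> 0"
    by (rule tendsto_sandwich[OF _ _ tendsto_const LIMSEQ_inverse_real_of_nat])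
      (use * in \<open>auto intro!: always_eventually less_imp_le\<close>)
  with * that show ?thesis by blast
qed

section \<open>Characteristic functions of Gaussian variables\<close>

text \<open>The factor \<open>iexp b\<close> has modulus 1, and the zeroth-order Taylor bound
  applies to \<open>iexp (a - b)\<close>.\<close>

lemma norm_iexp_diff_le: "cmod (iexp a - iexp b) \<le> \<bar>a - b\<bar>"
proof -
  have "iexp a - iexp b = iexp b * (iexp (a - b) - 1)"
    by (simp add: algebra_simps flip: exp_add)
  then have "cmod (iexp a - iexp b) = cmod (iexp (a - b) - 1)"
    by (simp add: norm_mult)
  also have "\<dots> \<le> \<bar>a - b\<bar>"
    using iexp_approx1[of "a - b" 0] by simp
  finally show ?thesis .
qed

lemma (in prob_space) integrable_iexp_real:
  "U \<in> borel_measurable M \<Longrightarrow> complex_integrable M (\<lambda>\<omega>. iexp (U \<omega>))"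
  by (rule integrable_iexp) auto

text \<open>At a fixed frequency the characteristic function is Lipschitz in the L2 distance, which
  is what carries Gaussianity over to L2-limits.\<close>

lemma (in prob_space) norm_integral_iexp_diff_le:
  assumes U: "U \<in> L2 M" and V: "V \<in> L2 M"
  shows "cmod ((CLINT \<omega>|M. iexp (u * U \<omega>)) - (CLINT \<omega>|M. iexp (u * V \<omega>)))
    \<le> \<bar>u\<bar> * sqrt (expectation (\<lambda>\<omega>. (U \<omega> - V \<omega>)\<^sup>2))"
proof -
  have D: "(\<lambda>\<omega>. U \<omega> - V \<omega>) \<in> L2 M" using U V by (rule L2_diff)
  have [measurable]: "U \<in> borel_measurable M" "V \<in> borel_measurable M"
    using U V by (auto dest: L2_measurable)
  have int: "complex_integrable M (\<lambda>\<omega>. iexp (u * U \<omega>))" "complex_integrable M (\<lambda>\<omega>. iexp (u * V \<omega>))"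
    by (rule integrable_iexp_real, measurable)+
  have "cmod ((CLINT \<omega>|M. iexp (u * U \<omega>)) - (CLINT \<omega>|M. iexp (u * V \<omega>)))
      = cmod (CLINT \<omega>|M. iexp (u * U \<omega>) - iexp (u * V \<omega>))"
    using int by simp
  also have "\<dots> \<le> (\<integral>\<omega>. cmod (iexp (u * U \<omega>) - iexp (u * V \<omega>)) \<partial>M)"
    by (rule integral_norm_bound)
  also have "\<dots> \<le> (\<integral>\<omega>. \<bar>u\<bar> * \<bar>U \<omega> - V \<omega>\<bar> \<partial>M)"
  proof (rule integral_mono)
    show "integrable M (\<lambda>\<omega>. cmod (iexp (u * U \<omega>) - iexp (u * V \<omega>)))"
      using int by (intro integrable_norm Bochner_Integration.integrable_diff)
    show "integrable M (\<lambda>\<omega>. \<bar>u\<bar> * \<bar>U \<omega> - V \<omega>\<bar>)"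
      using L2_integrable[OF D] by simp
    show "cmod (iexp (u * U \<omega>) - iexp (u * V \<omega>)) \<le> \<bar>u\<bar> * \<bar>U \<omega> - V \<omega>\<bar>" for \<omega>
      using norm_iexp_diff_le[of "u * U \<omega>" "u * V \<omega>"]
      by (simp add: abs_mult flip: right_diff_distrib)
  qed
  also have "\<dots> = \<bar>u\<bar> * expectation (\<lambda>\<omega>. \<bar>U \<omega> - V \<omega>\<bar>)"
    by simp
  also have "\<dots> \<le> \<bar>u\<bar> * sqrt (expectation (\<lambda>\<omega>. (U \<omega> - V \<omega>)\<^sup>2))"
    using L2_expectation_abs_le[OF D] by (intro mult_left_mono) auto
  finally show ?thesis .
qed

lemma (in prob_space) gaussian_rv_integral_iexp:
  assumes "gaussian_rv M V" "expectation V = 0"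
  shows "(CLINT \<omega>|M. iexp (u * V \<omega>)) =
    complex_of_real (exp (- (u\<^sup>2 * expectation (\<lambda>\<omega>. (V \<omega>)\<^sup>2) / 2)))"
proof -
  have V [measurable]: "V \<in> borel_measurable M" using assms(1) by (simp add: gaussian_rv_def)
  from assms(1) consider (const) \<mu> where "AE \<omega> in M. V \<omega> = \<mu>"
    | (normal) \<mu> \<sigma> where "\<sigma> > 0" "distributed M lborel V (\<lambda>x. ennreal (normal_density \<mu> \<sigma> x))"
    unfolding gaussian_rv_def by blast
  then show ?thesis
  proof cases
    case const
    \<comment> \<open>A constant with mean zero is zero, and the formula reduces to 1 = exp
      0.\<close>
    have "expectation V = (\<integral>\<omega>. \<mu> \<partial>M)" using const by (intro integral_cong_AE) auto
    then have "\<mu> = 0" using assms(2) by (simp add: prob_space)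
    then have ae: "AE \<omega> in M. V \<omega> = 0" using const by simp
    have "expectation (\<lambda>\<omega>. (V \<omega>)\<^sup>2) = (\<integral>\<omega>. 0 \<partial>M)"
      using ae by (intro integral_cong_AE) auto
    moreover have "(CLINT \<omega>|M. iexp (u * V \<omega>)) = (CLINT \<omega>|M. 1)"
      using ae by (intro integral_cong_AE) auto
    ultimately show ?thesis by (simp add: prob_space)
  next
    case normal
    have "\<mu> = 0" using normal_distributed_expectation[OF normal] assms(2) by simp
    have var: "expectation (\<lambda>\<omega>. (V \<omega>)\<^sup>2) = \<sigma>\<^sup>2"
      using normal_distributed_variance[OF normal] assms(2) by simp
    have std: "distributed M lborel (\<lambda>\<omega>. V \<omega> / \<sigma>) std_normal_density"
      using normal_standard_normal_convert[OF normal(1), of V \<mu>] normal(2) \<open>\<mu> = 0\<close> by simp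
    have "std_normal_distribution = distr M lborel (\<lambda>\<omega>. V \<omega> / \<sigma>)"
      using distributed_distr_eq_density[OF std] by simp
    then have "char std_normal_distribution (u * \<sigma>) =
        (CLINT x|distr M lborel (\<lambda>\<omega>. V \<omega> / \<sigma>). iexp (u * \<sigma> * x))"
      by (simp only: char_def)
    also have "\<dots> = (CLINT \<omega>|M. iexp (u * \<sigma> * (V \<omega> / \<sigma>)))"
      by (rule integral_distr) simp_all
    also have "\<dots> = (CLINT \<omega>|M. iexp (u * V \<omega>))"
    proof -
      have "u * \<sigma> * (V \<omega> / \<sigma>) = u * V \<omega>" for \<omega> using normal(1) by simp
      then show ?thesis by (simp only:)
    qed
    finally show ?thesis
      using var by (simp add: char_std_normal_distribution power_mult_distrib)
  qed
qed

text \<open>Both sides are continuous along an L2-approximation by finite combinations, where the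
  formula is the Gaussian one. As the linear space is closed under linear combinations, this scalar
  formula determines all joint laws of its elements, in the manner of Cramer and Wold.\<close>

lemma (in prob_space) lin_space_integral_iexp:
  assumes gauss: "gaussian_process M T Z"
    and L2: "\<And>s. s \<in> {0..T} \<Longrightarrow> Z s \<in> L2 M"
    and mean: "\<And>s. s \<in> {0..T} \<Longrightarrow> expectation (Z s) = 0"
    and U: "U \<in> lin_space M Z T"
  shows "(CLINT \<omega>|M. iexp (u * U \<omega>)) =
    complex_of_real (exp (- (u\<^sup>2 * expectation (\<lambda>\<omega>. (U \<omega>)\<^sup>2) / 2)))"
proof -
  obtain S c where S: "\<And>m :: nat. finite (S m)" "\<And>m. S m \<subseteq> {0..T}"
    and lim: "(\<lambda>m. \<integral>\<omega>. (U \<omega> - (\<Sum>s\<in>S m. c m s * Z s \<omega>))\<^sup>2 \<partial>M) \<longlonglongrightarrow> 0"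
    using lin_space_sequence[OF U] by blast
  define V where "V m \<omega> = (\<Sum>s\<in>S m. c m s * Z s \<omega>)" for m \<omega>
  have UL: "U \<in> L2 M" using U by (simp add: lin_space_def)
  have VL: "V m \<in> L2 M" for m
    unfolding V_def using S(2)[of m] by (intro L2_sum L2_cmult L2) auto
  have lim': "(\<lambda>m. \<integral>\<omega>. (U \<omega> - V m \<omega>)\<^sup>2 \<partial>M) \<longlonglongrightarrow> 0"
    using lim by (simp add: V_def)
  have char_V: "(CLINT \<omega>|M. iexp (u * V m \<omega>)) =
      complex_of_real (exp (- (u\<^sup>2 * expectation (\<lambda>\<omega>. (V m \<omega>)\<^sup>2) / 2)))" for m
  proof (rule gaussian_rv_integral_iexp)
    show "gaussian_rv M (V m)"
      using gauss S unfolding gaussian_process_def V_def[abs_def] by blast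
    have "expectation (V m) = (\<Sum>s\<in>S m. c m s * expectation (Z s))"
      unfolding V_def using S(2)[of m] L2_integrable[OF L2]
      by (subst Bochner_Integration.integral_sum) auto
    also have "\<dots> = 0" using mean S(2)[of m] by (intro sum.neutral) auto
    finally show "expectation (V m) = 0" .
  qed
  have "(\<lambda>m. CLINT \<omega>|M. iexp (u * V m \<omega>)) \<longlonglongrightarrow> (CLINT \<omega>|M. iexp (u * U \<omega>))"
  proof (rule LIM_zero_cancel, rule Lim_null_comparison)
    show "(\<lambda>m. \<bar>u\<bar> * sqrt (\<integral>\<omega>. (U \<omega> - V m \<omega>)\<^sup>2 \<partial>M)) \<longlonglongrightarrow> 0"
      using tendsto_mult_left[OF tendsto_real_sqrt[OF lim'], of "\<bar>u\<bar>"] by simp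
    show "\<forall>\<^sub>F m in sequentially. cmod ((CLINT \<omega>|M. iexp (u * V m \<omega>)) - (CLINT \<omega>|M. iexp (u * U \<omega>)))
        \<le> \<bar>u\<bar> * sqrt (\<integral>\<omega>. (U \<omega> - V m \<omega>)\<^sup>2 \<partial>M)"
      using norm_integral_iexp_diff_le[OF UL VL, of u]
      by (intro always_eventually allI) (simp add: norm_minus_commute)
  qed
  moreover have "(\<lambda>m. CLINT \<omega>|M. iexp (u * V m \<omega>)) \<longlonglongrightarrow>
      complex_of_real (exp (- (u\<^sup>2 * expectation (\<lambda>\<omega>. (U \<omega>)\<^sup>2) / 2)))"
    unfolding char_V using L2_tendsto_integral_square[OF UL VL lim']
    by (intro tendsto_of_real tendsto_exp tendsto_minus tendsto_divide tendsto_mult tendsto_const) auto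
  ultimately show ?thesis by (rule LIMSEQ_unique)
qed

section \<open>Independence from characteristic functions\<close>

text \<open>The weights \<open>\<bar>G\<bar> + 1 + G\<close> and \<open>\<bar>G\<bar> + 1\<close> turn the uniqueness theorem for characteristic
  functions of probability measures into one for signed measures.\<close>

lemma (in prob_space) integral_indicator_eq_0_real:
  fixes G Z :: "'a \<Rightarrow> real"
  assumes G: "integrable M G" and Z [measurable]: "random_variable borel Z"
    and char0: "\<And>u. (CLINT \<omega>|M. G \<omega> * iexp (u * Z \<omega>)) = 0"
    and B: "B \<in> sets borel"
  shows "(\<integral>\<omega>. G \<omega> * indicator B (Z \<omega>) \<partial>M) = 0"
proof -
  have [measurable]: "G \<in> borel_measurable M" using G by simp
  have [measurable]: "B \<in> sets borel" by (rule B)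
  have "(CLINT \<omega>|M. complex_of_real (G \<omega>)) = 0" using char0[of 0] by simp
  then have G0: "(\<integral>\<omega>. G \<omega> \<partial>M) = 0" by simp
  \<comment> \<open>The hypothesis at frequency 0 says that G has mean zero, so both weights have
    the same mass k; the summand 1 keeps k positive even if G vanishes.\<close>
  define k where "k = (\<integral>\<omega>. \<bar>G \<omega>\<bar> \<partial>M) + 1"
  have "k \<ge> 1" by (simp add: k_def)
  define p where "p \<omega> = (\<bar>G \<omega>\<bar> + 1 + G \<omega>) / k" for \<omega>
  define q where "q \<omega> = (\<bar>G \<omega>\<bar> + 1) / k" for \<omega>
  have [measurable]: "p \<in> borel_measurable M" "q \<in> borel_measurable M"
    unfolding p_def q_def by measurable
  have p_nonneg: "0 \<le> p \<omega>" and q_nonneg: "0 \<le> q \<omega>" for \<omega>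
    using \<open>k \<ge> 1\<close> by (auto simp: p_def q_def)
  have p_int: "integrable M p" and q_int: "integrable M q"
    unfolding p_def[abs_def] q_def[abs_def] using G by auto
  have p1: "(\<integral>\<omega>. p \<omega> \<partial>M) = 1" and q1: "(\<integral>\<omega>. q \<omega> \<partial>M) = 1"
  proof -
    have "(\<integral>\<omega>. \<bar>G \<omega>\<bar> + 1 + G \<omega> \<partial>M) = k" "(\<integral>\<omega>. \<bar>G \<omega>\<bar> + 1 \<partial>M) = k"
      using G G0 by (simp_all add: k_def prob_space)
    then show "(\<integral>\<omega>. p \<omega> \<partial>M) = 1" "(\<integral>\<omega>. q \<omega> \<partial>M) = 1"
      using \<open>k \<ge> 1\<close> by (simp_all add: p_def q_def del: Bochner_Integration.integral_add)
  qed
  have prob_density: "prob_space (density M (\<lambda>\<omega>. ennreal (w \<omega>)))"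
    if "integrable M w" "\<And>\<omega>. 0 \<le> w \<omega>" "(\<integral>\<omega>. w \<omega> \<partial>M) = 1" for w
    using that by (intro prob_spaceI) (simp add: emeasure_density nn_integral_eq_integral)
  define P where "P = distr (density M (\<lambda>\<omega>. ennreal (p \<omega>))) borel Z"
  define Q where "Q = distr (density M (\<lambda>\<omega>. ennreal (q \<omega>))) borel Z"
  have P: "real_distribution P" unfolding P_def
    using prob_density[OF p_int p_nonneg p1] by (rule prob_space.real_distribution_distr) simp
  have Q: "real_distribution Q" unfolding Q_def
    using prob_density[OF q_int q_nonneg q1] by (rule prob_space.real_distribution_distr) simp
  \<comment> \<open>The two densities differ by G / k, whose transform along Z vanishes by
    \<open>char0\<close>.\<close>
  have "char P u = char Q u" for u
  proof -
    have "(CLINT \<omega>|M. p \<omega> *\<^sub>R iexp (u * Z \<omega>))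
        = (CLINT \<omega>|M. q \<omega> *\<^sub>R iexp (u * Z \<omega>) + (G \<omega> * iexp (u * Z \<omega>)) / k)"
      unfolding p_def q_def
      by (intro Bochner_Integration.integral_cong refl)
        (simp add: scaleR_conv_of_real add_divide_distrib ring_distribs)
    also have "\<dots> = (CLINT \<omega>|M. q \<omega> *\<^sub>R iexp (u * Z \<omega>)) + (CLINT \<omega>|M. (G \<omega> * iexp (u * Z \<omega>)) / k)"
    proof (rule Bochner_Integration.integral_add)
      show "complex_integrable M (\<lambda>\<omega>. q \<omega> *\<^sub>R iexp (u * Z \<omega>))"
        by (rule Bochner_Integration.integrable_bound[OF q_int]) auto
      have "complex_integrable M (\<lambda>\<omega>. G \<omega> * iexp (u * Z \<omega>))"
        by (rule Bochner_Integration.integrable_bound[OF G]) (auto simp: norm_mult)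
      then show "complex_integrable M (\<lambda>\<omega>. (G \<omega> * iexp (u * Z \<omega>)) / k)" by simp
    qed
    finally have "(CLINT \<omega>|M. p \<omega> *\<^sub>R iexp (u * Z \<omega>)) = (CLINT \<omega>|M. q \<omega> *\<^sub>R iexp (u * Z \<omega>))"
      using char0 by simp
    then show ?thesis
      unfolding char_def P_def Q_def using p_nonneg q_nonneg
      by (simp add: integral_distr integral_density)
  qed
  then have "P = Q" by (intro Levy_uniqueness[OF P Q] ext)
  then have "(\<integral>x. indicator B x \<partial>P) = (\<integral>x. indicator B x \<partial>Q :: real)" by simp
  then have eq: "(\<integral>\<omega>. p \<omega> * indicator B (Z \<omega>) \<partial>M) = (\<integral>\<omega>. q \<omega> * indicator B (Z \<omega>) \<partial>M)"
    unfolding P_def Q_def using p_nonneg q_nonneg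
    by (simp add: integral_distr integral_density del: Bochner_Integration.integral_indicator)
  have "(\<integral>\<omega>. G \<omega> * indicator B (Z \<omega>) \<partial>M)
      = (\<integral>\<omega>. k * (p \<omega> * indicator B (Z \<omega>) - q \<omega> * indicator B (Z \<omega>)) \<partial>M)"
    using \<open>k \<ge> 1\<close> by (intro Bochner_Integration.integral_cong refl)
      (simp add: p_def q_def field_simps)
  also have "\<dots> = k * ((\<integral>\<omega>. p \<omega> * indicator B (Z \<omega>) \<partial>M) - (\<integral>\<omega>. q \<omega> * indicator B (Z \<omega>) \<partial>M))"
  proof -
    have "integrable M (\<lambda>\<omega>. p \<omega> * indicator B (Z \<omega>))"
      by (rule Bochner_Integration.integrable_bound[OF p_int]) (auto split: split_indicator)
    moreover have "integrable M (\<lambda>\<omega>. q \<omega> * indicator B (Z \<omega>))"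
      by (rule Bochner_Integration.integrable_bound[OF q_int]) (auto split: split_indicator)
    ultimately show ?thesis by simp
  qed
  finally show ?thesis using eq by simp
qed

text \<open>Real and imaginary part of the weight are combinations of G and its conjugate. The
  conjugate satisfies the same hypothesis, since conjugation only turns the frequency u into
  -u.\<close>

lemma (in prob_space) integral_indicator_eq_0_complex:
  fixes G :: "'a \<Rightarrow> complex" and Z :: "'a \<Rightarrow> real"
  assumes G: "complex_integrable M G" and Z [measurable]: "random_variable borel Z"
    and char0: "\<And>u. (CLINT \<omega>|M. G \<omega> * iexp (u * Z \<omega>)) = 0"
    and B: "B \<in> sets borel"
  shows "(CLINT \<omega>|M. G \<omega> * indicator B (Z \<omega>)) = 0"
proof -
  have [measurable]: "G \<in> borel_measurable M" using G by simp
  have [measurable]: "B \<in> sets borel" by (rule B)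
  have int: "complex_integrable M (\<lambda>\<omega>. H \<omega> * iexp (u * Z \<omega>))" if "complex_integrable M H" for H u
    using that by (rule Bochner_Integration.integrable_bound)
      (use that in \<open>auto simp: norm_mult\<close>)
  have Gc: "complex_integrable M (\<lambda>\<omega>. cnj (G \<omega>))" using G by simp
  have cnj0: "(CLINT \<omega>|M. cnj (G \<omega>) * iexp (u * Z \<omega>)) = 0" for u
  proof -
    have "(CLINT \<omega>|M. cnj (G \<omega>) * iexp (u * Z \<omega>)) = (CLINT \<omega>|M. cnj (G \<omega> * iexp (- u * Z \<omega>)))"
      by (intro Bochner_Integration.integral_cong refl) (simp add: exp_cnj)
    also have "\<dots> = cnj (CLINT \<omega>|M. G \<omega> * iexp (- u * Z \<omega>))" by (rule Bochner_Integration.integral_cnj)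
    finally show ?thesis using char0[of "- u"] by simp
  qed
  have "(\<integral>\<omega>. Re (G \<omega>) * indicator B (Z \<omega>) \<partial>M) = 0"
  proof (rule integral_indicator_eq_0_real[OF _ Z _ B])
    show "integrable M (\<lambda>\<omega>. Re (G \<omega>))" using G by simp
    fix u
    have "(CLINT \<omega>|M. Re (G \<omega>) * iexp (u * Z \<omega>)) =
        (CLINT \<omega>|M. (G \<omega> * iexp (u * Z \<omega>) + cnj (G \<omega>) * iexp (u * Z \<omega>)) / 2)"
      by (intro Bochner_Integration.integral_cong refl)
        (simp add: complex_add_cnj flip: distrib_right)
    also have "\<dots> = 0"
      using int[OF G, of u] int[OF Gc, of u] char0[of u] cnj0[of u] by simp
    finally show "(CLINT \<omega>|M. Re (G \<omega>) * iexp (u * Z \<omega>)) = 0" .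
  qed
  moreover have "(\<integral>\<omega>. Im (G \<omega>) * indicator B (Z \<omega>) \<partial>M) = 0"
  proof (rule integral_indicator_eq_0_real[OF _ Z _ B])
    show "integrable M (\<lambda>\<omega>. Im (G \<omega>))" using G by simp
    fix u
    have "(CLINT \<omega>|M. Im (G \<omega>) * iexp (u * Z \<omega>)) =
        (CLINT \<omega>|M. (G \<omega> * iexp (u * Z \<omega>) - cnj (G \<omega>) * iexp (u * Z \<omega>)) / (2 * \<i>))"
      by (intro Bochner_Integration.integral_cong refl, subst eq_divide_eq)
        (simp add: complex_diff_cnj flip: left_diff_distrib)
    also have "\<dots> = 0"
      using int[OF G, of u] int[OF Gc, of u] char0[of u] cnj0[of u] by simp
    finally show "(CLINT \<omega>|M. Im (G \<omega>) * iexp (u * Z \<omega>)) = 0" .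
  qed
  moreover have GB: "complex_integrable M (\<lambda>\<omega>. G \<omega> * indicator B (Z \<omega>))"
    using G by (rule Bochner_Integration.integrable_bound) (auto split: split_indicator)
  have "Re (indicator B x) = indicator B x" "Im (indicator B x) = 0" for x :: real
    by (auto split: split_indicator)
  then have "Re (CLINT \<omega>|M. G \<omega> * indicator B (Z \<omega>)) = (\<integral>\<omega>. Re (G \<omega>) * indicator B (Z \<omega>) \<partial>M)"
      "Im (CLINT \<omega>|M. G \<omega> * indicator B (Z \<omega>)) = (\<integral>\<omega>. Im (G \<omega>) * indicator B (Z \<omega>) \<partial>M)"
    using GB by (simp_all flip: integral_Re integral_Im)
  ultimately show ?thesis by (simp add: complex_eq_iff)
qed

text \<open>Induction on the variables: the exponentials of the others are absorbed into the weight,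
  which is why weights are complex, and the one-variable result replaces the exponential of
  \<open>Z r\<close> by an indicator. That indicator then joins the weight for the remaining
  variables, so G must be arbitrary in the induction.\<close>

lemma (in prob_space) integral_prod_indicator_eq_0:
  fixes G :: "'a \<Rightarrow> complex" and Z :: "'i \<Rightarrow> 'a \<Rightarrow> real"
  assumes "finite S" and "complex_integrable M G"
    and "\<And>s. s \<in> S \<Longrightarrow> random_variable borel (Z s)"
    and "\<And>c. (CLINT \<omega>|M. G \<omega> * iexp (\<Sum>s\<in>S. c s * Z s \<omega>)) = 0"
    and "\<And>s. s \<in> S \<Longrightarrow> B s \<in> sets borel"
  shows "(CLINT \<omega>|M. G \<omega> * (\<Prod>s\<in>S. indicator (B s) (Z s \<omega>))) = 0"
  using assms
proof (induction S arbitrary: G)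
  case empty
  then show ?case by simp
next
  case (insert r S)
  have [measurable]: "G \<in> borel_measurable M" "random_variable borel (Z r)" "B r \<in> sets borel"
    using insert.prems by auto
  have [measurable]: "(\<lambda>\<omega>. \<Sum>s\<in>S. c s * Z s \<omega>) \<in> borel_measurable M" for c
    using insert.prems(2) by (intro borel_measurable_sum borel_measurable_times) auto
  let ?G = "\<lambda>\<omega>. G \<omega> * indicator (B r) (Z r \<omega>)"
  have "(CLINT \<omega>|M. ?G \<omega> * (\<Prod>s\<in>S. indicator (B s) (Z s \<omega>))) = 0"
  proof (rule insert.IH)
    show "complex_integrable M ?G"
      using insert.prems(1) by (rule Bochner_Integration.integrable_bound)
        (auto split: split_indicator)
    fix c :: "'i \<Rightarrow> real"
    have "(CLINT \<omega>|M. (G \<omega> * iexp (\<Sum>s\<in>S. c s * Z s \<omega>)) * indicator (B r) (Z r \<omega>)) = 0"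
    proof (rule integral_indicator_eq_0_complex)
      show "complex_integrable M (\<lambda>\<omega>. G \<omega> * iexp (\<Sum>s\<in>S. c s * Z s \<omega>))"
        using insert.prems(1)
      proof (rule Bochner_Integration.integrable_bound)
        show "(\<lambda>\<omega>. G \<omega> * iexp (\<Sum>s\<in>S. c s * Z s \<omega>)) \<in> borel_measurable M" by measurable
      qed (simp add: norm_mult del: of_real_sum)
      fix u
      have "(\<Sum>s\<in>insert r S. (c(r := u)) s * Z s \<omega>) = u * Z r \<omega> + (\<Sum>s\<in>S. c s * Z s \<omega>)" for \<omega>
        using insert.hyps by (auto intro!: sum.cong)
      then show "(CLINT \<omega>|M. G \<omega> * iexp (\<Sum>s\<in>S. c s * Z s \<omega>) * iexp (u * Z r \<omega>)) = 0"
        using insert.prems(3)[of "c(r := u)"] by (simp add: exp_add algebra_simps)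
    qed simp_all
    then show "(CLINT \<omega>|M. ?G \<omega> * iexp (\<Sum>s\<in>S. c s * Z s \<omega>)) = 0"
      by (simp add: mult_ac)
  qed (use insert.prems in auto)
  then show ?case using insert.hyps by (simp add: mult_ac)
qed

section \<open>Independence from the sigma algebra generated by a process\<close>

lemma space_sigma_gen [simp]: "space (sigma_gen M Z D) = space M"
  by (simp add: sigma_gen_def space_measure_of_conv)

lemma sets_sigma_gen:
  "sets (sigma_gen M Z D) =
    sigma_sets (space M) {Z t -` B \<inter> space M | t B. t \<in> D \<and> B \<in> sets borel}"
  unfolding sigma_gen_def by (subst sets_measure_of) auto

lemma measurable_sigma_gen: "t \<in> D \<Longrightarrow> Z t \<in> borel_measurable (sigma_gen M Z D)"
  by (rule measurableI) (auto simp: sets_sigma_gen intro!: sigma_sets.Basic)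

lemma subalgebra_sigma_gen:
  assumes "\<And>t. t \<in> D \<Longrightarrow> Z t \<in> borel_measurable M"
  shows "subalgebra M (sigma_gen M Z D)"
  unfolding subalgebra_def sets_sigma_gen space_sigma_gen
proof (intro conjI refl sets.sigma_sets_subset subsetI)
  fix A assume "A \<in> {Z t -` B \<inter> space M | t B. t \<in> D \<and> B \<in> sets borel}"
  then show "A \<in> sets M" using measurable_sets[OF assms] by blast
qed

text \<open>Finite-dimensional cylinders form an intersection-stable generator. The indicator of a
  cylinder is the product in \<open>integral_prod_indicator_eq_0\<close>, and the measurable sets
  over which G integrates to 0 form a Dynkin system.\<close>

lemma (in prob_space) set_integral_sigma_gen_eq_0:
  fixes G :: "'a \<Rightarrow> complex" and Z :: "real \<Rightarrow> 'a \<Rightarrow> real"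
  assumes G: "complex_integrable M G"
    and Z: "\<And>s. s \<in> D \<Longrightarrow> random_variable borel (Z s)"
    and char0: "\<And>S c. finite S \<Longrightarrow> S \<subseteq> D \<Longrightarrow> (CLINT \<omega>|M. G \<omega> * iexp (\<Sum>s\<in>S. c s * Z s \<omega>)) = 0"
    and A: "A \<in> sets (sigma_gen M Z D)"
  shows "(CLINT \<omega>:A|M. G \<omega>) = 0"
proof -
  define P where "P = {{\<omega> \<in> space M. \<forall>s\<in>S. Z s \<omega> \<in> B s} | S B. finite S \<and> S \<subseteq> D \<and> (\<forall>s\<in>S. B s \<in> sets borel)}"
  have meas: "E \<in> sets M" if "E \<in> P" for E
  proof -
    from that obtain S B where E: "E = {\<omega> \<in> space M. \<forall>s\<in>S. Z s \<omega> \<in> B s}"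
      "finite S" "S \<subseteq> D" "\<forall>s\<in>S. B s \<in> sets borel" unfolding P_def by blast
    have "{\<omega> \<in> space M. Z s \<omega> \<in> B s} \<in> sets M" if "s \<in> S" for s
      using measurable_sets[OF Z, of s "B s"] that E by (auto simp: vimage_def Int_def conj_commute)
    then show ?thesis unfolding E(1) using E(2) by (intro sets.sets_Collect_finite_All) auto
  qed
  have "A \<in> sigma_sets (space M) P"
  proof -
    have "{Z t -` B \<inter> space M | t B. t \<in> D \<and> B \<in> sets borel} \<subseteq> P"
    proof safe
      fix t and B :: "real set" assume "t \<in> D" "B \<in> sets borel"
      then show "Z t -` B \<inter> space M \<in> P"
        unfolding P_def by (intro CollectI exI[of _ "{t}"] exI[of _ "\<lambda>_. B"]) auto
    qed
    from sigma_sets_subseteq[OF this] show ?thesis using A unfolding sets_sigma_gen by blast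
  qed
  moreover have "Int_stable P"
  proof (rule Int_stableI)
    fix E F assume "E \<in> P" "F \<in> P"
    then obtain S B S' B' where
      E: "E = {\<omega> \<in> space M. \<forall>s\<in>S. Z s \<omega> \<in> B s}" "finite S" "S \<subseteq> D" "\<forall>s\<in>S. B s \<in> sets borel" and
      F: "F = {\<omega> \<in> space M. \<forall>s\<in>S'. Z s \<omega> \<in> B' s}" "finite S'" "S' \<subseteq> D" "\<forall>s\<in>S'. B' s \<in> sets borel"
      unfolding P_def by blast
    \<comment> \<open>A cylinder puts no restriction on an index that occurs only in the other one,
      hence \<open>UNIV\<close>.\<close>
    define C where "C s = (if s \<in> S then B s else UNIV) \<inter> (if s \<in> S' then B' s else UNIV)" for s
    have "E \<inter> F = {\<omega> \<in> space M. \<forall>s\<in>S \<union> S'. Z s \<omega> \<in> C s}"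
      unfolding E(1) F(1) C_def by auto
    moreover have "\<forall>s\<in>S \<union> S'. C s \<in> sets borel" using E(4) F(4) by (auto simp: C_def)
    ultimately show "E \<inter> F \<in> P"
      unfolding P_def using E(2,3) F(2,3)
      by (intro CollectI exI[of _ "S \<union> S'"] exI[of _ C]) auto
  qed
  moreover have "P \<subseteq> Pow (space M)" by (auto simp: P_def)
  ultimately have "Int_stable P" "P \<subseteq> Pow (space M)" "A \<in> sigma_sets (space M) P"
    by blast+
  then have "A \<in> sets M \<and> (CLINT \<omega>:A|M. G \<omega>) = 0"
  proof (induction rule: sigma_sets_induct_disjoint[of P "space M"])
    case (basic E)
    then obtain S B where E: "E = {\<omega> \<in> space M. \<forall>s\<in>S. Z s \<omega> \<in> B s}"
      "finite S" "S \<subseteq> D" "\<forall>s\<in>S. B s \<in> sets borel" unfolding P_def by blast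
    have "(CLINT \<omega>:E|M. G \<omega>) = (CLINT \<omega>|M. G \<omega> * (\<Prod>s\<in>S. indicator (B s) (Z s \<omega>)))"
      unfolding set_lebesgue_integral_def
    proof (intro Bochner_Integration.integral_cong refl)
      fix \<omega> assume "\<omega> \<in> space M"
      have "(\<Prod>s\<in>S. indicator (B s) (Z s \<omega>)) = (indicator E \<omega> :: complex)"
        using \<open>\<omega> \<in> space M\<close> E(2) by (auto simp: E(1) indicator_def)
      then show "indicator E \<omega> *\<^sub>R G \<omega> = G \<omega> * (\<Prod>s\<in>S. indicator (B s) (Z s \<omega>))"
        by (simp split: split_indicator)
    qed
    also have "\<dots> = 0"
      by (rule integral_prod_indicator_eq_0[OF E(2) G]) (use E Z char0 in auto)
    finally show ?case using meas[OF basic] by simp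
  next
    case empty
    then show ?case by (simp add: set_lebesgue_integral_def)
  next
    case (compl E)
    \<comment> \<open>The empty combination turns the exponential into 1, so the total integral of G
      vanishes.\<close>
    have "(CLINT \<omega>|M. G \<omega>) = 0" using char0[of "{}"] by simp
    then have "(CLINT \<omega>:space M|M. G \<omega>) = 0" by (simp add: set_integral_space[OF G])
    moreover have "(CLINT \<omega>:E \<union> (space M - E)|M. G \<omega>) = (CLINT \<omega>:E|M. G \<omega>) + (CLINT \<omega>:space M - E|M. G \<omega>)"
      using compl G unfolding set_integrable_def
      by (intro set_integral_Un) (auto simp: set_integrable_def intro!: integrable_mult_indicator)
    moreover have "E \<union> (space M - E) = space M" using compl sets.sets_into_space by blast
    ultimately show ?case using compl by auto
  next
    case (union E)
    then have E: "\<And>i. E i \<in> sets M" "\<And>i. (CLINT \<omega>:E i|M. G \<omega>) = 0" by auto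
    have "(CLINT \<omega>:(\<Union>i. E i)|M. G \<omega>) = (\<Sum>i. CLINT \<omega>:E i|M. G \<omega>)"
      using E(1) union(1) G
      by (intro lebesgue_integral_countable_add)
        (auto simp: set_integrable_def disjoint_family_on_def intro!: integrable_mult_indicator)
    then show ?case using E by auto
  qed
  then show ?thesis ..
qed

text \<open>The annihilation argument runs twice. By \<open>factor\<close>, the centered weight
  \<open>iexp (u * R \<omega>) - \<psi>\<close> is orthogonal to all exponentials of the process,
  hence integrates to 0 over A. This says that the weight
  \<open>indicator A \<omega> - prob A\<close> is orthogonal to all exponentials of R, hence also to
  indicators of R.\<close>

lemma (in prob_space) prob_Int_vimage_sigma_gen:
  fixes R :: "'a \<Rightarrow> real" and Z :: "real \<Rightarrow> 'a \<Rightarrow> real"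
  assumes R [measurable]: "random_variable borel R"
    and Z: "\<And>s. s \<in> D \<Longrightarrow> random_variable borel (Z s)"
    and factor: "\<And>S c u. finite S \<Longrightarrow> S \<subseteq> D \<Longrightarrow>
      (CLINT \<omega>|M. iexp (u * R \<omega> + (\<Sum>s\<in>S. c s * Z s \<omega>))) =
      (CLINT \<omega>|M. iexp (u * R \<omega>)) * (CLINT \<omega>|M. iexp (\<Sum>s\<in>S. c s * Z s \<omega>))"
    and A: "A \<in> sets (sigma_gen M Z D)" and B [measurable]: "B \<in> sets borel"
  shows "prob (A \<inter> (R -` B \<inter> space M)) = prob A * prob (R -` B \<inter> space M)"
proof -
  have "subalgebra M (sigma_gen M Z D)" by (rule subalgebra_sigma_gen[OF Z])
  with A have [measurable]: "A \<in> sets M" unfolding subalgebra_def by blast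
  have *: "(CLINT \<omega>|M. complex_of_real (indicator A \<omega> - prob A) * iexp (u * R \<omega>)) = 0" for u
  proof -
    define \<psi> where "\<psi> = (CLINT \<omega>|M. iexp (u * R \<omega>))"
    have int: "complex_integrable M (\<lambda>\<omega>. iexp (u * R \<omega>))" by (rule integrable_iexp_real) simp
    have "(CLINT \<omega>:A|M. iexp (u * R \<omega>) - \<psi>) = 0"
    proof (rule set_integral_sigma_gen_eq_0[OF _ Z _ A])
      show "complex_integrable M (\<lambda>\<omega>. iexp (u * R \<omega>) - \<psi>)" using int by simp
      fix S and c :: "real \<Rightarrow> real" assume S: "finite S" "S \<subseteq> D"
      have [measurable]: "(\<lambda>\<omega>. \<Sum>s\<in>S. c s * Z s \<omega>) \<in> borel_measurable M"
        using S Z by (intro borel_measurable_sum borel_measurable_times) auto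
      have "(CLINT \<omega>|M. (iexp (u * R \<omega>) - \<psi>) * iexp (\<Sum>s\<in>S. c s * Z s \<omega>)) =
          (CLINT \<omega>|M. iexp (u * R \<omega> + (\<Sum>s\<in>S. c s * Z s \<omega>)) - \<psi> * iexp (\<Sum>s\<in>S. c s * Z s \<omega>))"
        by (intro Bochner_Integration.integral_cong refl)
          (simp add: exp_add ring_distribs del: of_real_sum)
      also have "\<dots> = (CLINT \<omega>|M. iexp (u * R \<omega> + (\<Sum>s\<in>S. c s * Z s \<omega>)))
          - \<psi> * (CLINT \<omega>|M. iexp (\<Sum>s\<in>S. c s * Z s \<omega>))"
        by (subst Bochner_Integration.integral_diff)
          (auto intro!: integrable_mult_right integrable_iexp_real simp del: of_real_sum of_real_add)
      also have "\<dots> = 0" using factor[OF S] by (simp add: \<psi>_def)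
      finally show "(CLINT \<omega>|M. (iexp (u * R \<omega>) - \<psi>) * iexp (\<Sum>s\<in>S. c s * Z s \<omega>)) = 0" .
    qed
    moreover have "complex_integrable M (\<lambda>\<omega>. indicator A \<omega> *\<^sub>R iexp (u * R \<omega>))"
      using int by (intro integrable_mult_indicator) auto
    moreover have "complex_integrable M (\<lambda>\<omega>. indicator A \<omega> *\<^sub>R \<psi>)"
      by (intro integrable_mult_indicator) auto
    ultimately have "(CLINT \<omega>|M. indicator A \<omega> *\<^sub>R iexp (u * R \<omega>)) = (CLINT \<omega>|M. indicator A \<omega> *\<^sub>R \<psi>)"
      by (simp add: set_lebesgue_integral_def scaleR_diff_right)
    also have "\<dots> = prob A * \<psi>"
      by (simp add: scaleR_conv_of_real)
    finally show ?thesis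
      using int \<open>complex_integrable M (\<lambda>\<omega>. indicator A \<omega> *\<^sub>R iexp (u * R \<omega>))\<close>
      by (simp add: scaleR_conv_of_real left_diff_distrib \<psi>_def)
  qed
  define C where "C = R -` B \<inter> space M"
  have [measurable]: "C \<in> sets M" unfolding C_def by measurable
  have "(\<integral>\<omega>. (indicator A \<omega> - prob A) * indicator B (R \<omega>) \<partial>M) = 0"
  proof (rule integral_indicator_eq_0_real[OF _ R * B])
    show "integrable M (\<lambda>\<omega>. indicat_real A \<omega> - prob A)"
      by (intro Bochner_Integration.integrable_diff integrable_const integrable_real_indicator)
        (simp_all add: emeasure_eq_measure)
  qed
  moreover have "(\<integral>\<omega>. (indicator A \<omega> - prob A) * indicator B (R \<omega>) \<partial>M) =
      (\<integral>\<omega>. indicat_real (A \<inter> C) \<omega> - prob A * indicat_real C \<omega> \<partial>M)"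
    by (intro Bochner_Integration.integral_cong refl) (auto simp: C_def split: split_indicator)
  moreover have "\<dots> = prob (A \<inter> C) - prob A * prob C"
    by (subst Bochner_Integration.integral_diff) (simp_all add: emeasure_eq_measure)
  ultimately show ?thesis by (simp add: C_def)
qed

section \<open>The Wiener integral\<close>

lemma step_integral_Nil [simp]: "step_integral x [] \<omega> = 0"
  by (simp add: step_integral_def)

lemma step_integral_Cons [simp]:
  "step_integral x ((c, a, b) # p) \<omega> = c * (x b \<omega> - x a \<omega>) + step_integral x p \<omega>"
  by (simp add: step_integral_def)

lemma step_integral_append:
  "step_integral x (p @ q) \<omega> = step_integral x p \<omega> + step_integral x q \<omega>"
  by (simp add: step_integral_def)

lemma step_integral_negate:
  "step_integral x (map (\<lambda>(c, ab). (- c, ab)) p) \<omega> = - step_integral x p \<omega>"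
  by (induction p) auto

text \<open>Integrating the indicators of \<open>(0, s]\<close> in place of \<open>W\<^sub>s\<close> turns step integrals into step functions,
  so facts about step integrals apply to both sides of the Ito isometry.\<close>

lemma step_fun_eq_step_integral:
  assumes "\<forall>(c, a, b)\<in>set p. 0 \<le> a \<and> a \<le> b \<and> b \<le> T"
  shows "step_fun p u = step_integral (\<lambda>s. indicator {0<..s}) p u"
  using assms
proof (induction p)
  case (Cons q p)
  obtain c a b where q: "q = (c, a, b)" by (cases q)
  have "indicat_real {a<..b} u = indicator {0<..b} u - indicator {0<..a} u"
    using Cons.prems q by (auto split: split_indicator)
  then show ?case using Cons q by (simp add: step_fun_def)
qed (simp add: step_fun_def)

lemma step_list_endpoints:
  assumes "\<forall>(c, a, b)\<in>set p. 0 \<le> a \<and> a \<le> b \<and> b \<le> (T :: real)"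
  shows "\<forall>(c, a, b)\<in>set p. a \<in> {0..T} \<and> b \<in> {0..T}"
proof safe
  fix c a b assume "(c, a, b) \<in> set p"
  with assms have "0 \<le> a \<and> a \<le> b \<and> b \<le> T" by blast
  then show "a \<in> {0..T}" "b \<in> {0..T}" by auto
qed

lemma step_integral_L2:
  assumes "\<And>s. s \<in> I \<Longrightarrow> x s \<in> L2 N" and "\<forall>(c, a, b)\<in>set p. a \<in> I \<and> b \<in> I"
  shows "step_integral x p \<in> L2 N"
  using assms(2)
proof (induction p)
  case Nil
  have "step_integral x [] = (\<lambda>\<omega>. 0)" by (simp add: fun_eq_iff)
  then show ?case by (simp add: L2_zero)
next
  case (Cons q p)
  obtain c a b where q: "q = (c, a, b)" by (cases q)
  have "step_integral x (q # p) = (\<lambda>\<omega>. c * (x b \<omega> - x a \<omega>) + step_integral x p \<omega>)"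
    by (simp add: q fun_eq_iff)
  also have "\<dots> \<in> L2 N"
    using Cons q by (intro L2_add L2_cmult L2_diff assms(1)) auto
  finally show ?case .
qed

text \<open>Polarisation on four points: a product of two increments is half a signed sum of squared
  increments, so squared increments determine all inner products of increments.\<close>

lemma integral_increment_product:
  assumes "x a \<in> L2 N" "x b \<in> L2 N" "x a' \<in> L2 N" "x b' \<in> L2 N"
  shows "(\<integral>\<omega>. (x b \<omega> - x a \<omega>) * (x b' \<omega> - x a' \<omega>) \<partial>N) =
    ((\<integral>\<omega>. (x b' \<omega> - x a \<omega>)\<^sup>2 \<partial>N) + (\<integral>\<omega>. (x b \<omega> - x a' \<omega>)\<^sup>2 \<partial>N)
      - (\<integral>\<omega>. (x b \<omega> - x b' \<omega>)\<^sup>2 \<partial>N) - (\<integral>\<omega>. (x a \<omega> - x a' \<omega>)\<^sup>2 \<partial>N)) / 2"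
proof -
  have "(\<lambda>\<omega>. (x b \<omega> - x a \<omega>) * (x b' \<omega> - x a' \<omega>)) =
      (\<lambda>\<omega>. ((x b' \<omega> - x a \<omega>)\<^sup>2 + (x b \<omega> - x a' \<omega>)\<^sup>2 - (x b \<omega> - x b' \<omega>)\<^sup>2 - (x a \<omega> - x a' \<omega>)\<^sup>2) / 2)"
    by (simp add: fun_eq_iff power2_eq_square field_simps)
  moreover have "integrable N (\<lambda>\<omega>. (x b' \<omega> - x a \<omega>)\<^sup>2)" "integrable N (\<lambda>\<omega>. (x b \<omega> - x a' \<omega>)\<^sup>2)"
    "integrable N (\<lambda>\<omega>. (x b \<omega> - x b' \<omega>)\<^sup>2)" "integrable N (\<lambda>\<omega>. (x a \<omega> - x a' \<omega>)\<^sup>2)"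
    using assms by (auto intro!: L2_integrable_square[OF L2_diff])
  ultimately show ?thesis by simp
qed

text \<open>Both sides are bilinear in the lists, and by polarisation the inner products of single
  increments agree. With Brownian motion on one side and the indicators of (0, s] on the other this
  is the Ito isometry for step functions; overlapping intervals need no common refinement.\<close>

lemma integral_step_integral_product_eq:
  assumes x: "\<And>s. s \<in> I \<Longrightarrow> x s \<in> L2 N" and y: "\<And>s. s \<in> I \<Longrightarrow> y s \<in> L2 N'"
    and eq: "\<And>r s. r \<in> I \<Longrightarrow> s \<in> I \<Longrightarrow>
      (\<integral>\<omega>. (x s \<omega> - x r \<omega>)\<^sup>2 \<partial>N) = (\<integral>\<omega>. (y s \<omega> - y r \<omega>)\<^sup>2 \<partial>N')"
    and p: "\<forall>(c, a, b)\<in>set p. a \<in> I \<and> b \<in> I" and q: "\<forall>(c, a, b)\<in>set q. a \<in> I \<and> b \<in> I"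
  shows "(\<integral>\<omega>. step_integral x p \<omega> * step_integral x q \<omega> \<partial>N) =
    (\<integral>\<omega>. step_integral y p \<omega> * step_integral y q \<omega> \<partial>N')"
  using p
proof (induction p)
  case (Cons e p)
  obtain c a b where e: "e = (c, a, b)" by (cases e)
  have ab: "a \<in> I" "b \<in> I" and p: "\<forall>(c, a, b)\<in>set p. a \<in> I \<and> b \<in> I" using Cons.prems e by auto
  have single: "(\<integral>\<omega>. (x b \<omega> - x a \<omega>) * step_integral x q \<omega> \<partial>N) =
      (\<integral>\<omega>. (y b \<omega> - y a \<omega>) * step_integral y q \<omega> \<partial>N')"
    using q
  proof (induction q)
    case (Cons e' q)
    obtain c' a' b' where e': "e' = (c', a', b')" by (cases e')
    have ab': "a' \<in> I" "b' \<in> I" and q: "\<forall>(c, a, b)\<in>set q. a \<in> I \<and> b \<in> I" using Cons.prems e' by auto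
    \<comment> \<open>Stated for a generic family, in order to serve both x over N and y over
      N'.\<close>
    have split: "(\<integral>\<omega>. (z b \<omega> - z a \<omega>) * step_integral z (e' # q) \<omega> \<partial>L) =
        c' * (\<integral>\<omega>. (z b \<omega> - z a \<omega>) * (z b' \<omega> - z a' \<omega>) \<partial>L)
        + (\<integral>\<omega>. (z b \<omega> - z a \<omega>) * step_integral z q \<omega> \<partial>L)"
      if z: "\<And>s. s \<in> I \<Longrightarrow> z s \<in> L2 L" for z :: "real \<Rightarrow> 'c \<Rightarrow> real" and L
    proof -
      have "integrable L (\<lambda>\<omega>. (z b \<omega> - z a \<omega>) * (z b' \<omega> - z a' \<omega>))"
        using ab ab' by (intro L2_integrable_mult L2_diff z)
      moreover have "integrable L (\<lambda>\<omega>. (z b \<omega> - z a \<omega>) * step_integral z q \<omega>)"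
        using ab by (intro L2_integrable_mult L2_diff z step_integral_L2[OF z q])
      moreover have "(\<lambda>\<omega>. (z b \<omega> - z a \<omega>) * step_integral z (e' # q) \<omega>) =
          (\<lambda>\<omega>. c' * ((z b \<omega> - z a \<omega>) * (z b' \<omega> - z a' \<omega>)) + (z b \<omega> - z a \<omega>) * step_integral z q \<omega>)"
        by (simp add: e' fun_eq_iff algebra_simps)
      ultimately show ?thesis by simp
    qed
    have "(\<integral>\<omega>. (x b \<omega> - x a \<omega>) * (x b' \<omega> - x a' \<omega>) \<partial>N) =
        (\<integral>\<omega>. (y b \<omega> - y a \<omega>) * (y b' \<omega> - y a' \<omega>) \<partial>N')"
      using ab ab' by (simp add: integral_increment_product x y eq)
    with Cons.IH[OF q] show ?case using split[of x N, OF x] split[of y N', OF y] by simp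
  qed simp
  have split: "(\<integral>\<omega>. step_integral z (e # p) \<omega> * step_integral z q \<omega> \<partial>L) =
      c * (\<integral>\<omega>. (z b \<omega> - z a \<omega>) * step_integral z q \<omega> \<partial>L)
      + (\<integral>\<omega>. step_integral z p \<omega> * step_integral z q \<omega> \<partial>L)"
    if z: "\<And>s. s \<in> I \<Longrightarrow> z s \<in> L2 L" for z :: "real \<Rightarrow> 'c \<Rightarrow> real" and L
  proof -
    have "integrable L (\<lambda>\<omega>. (z b \<omega> - z a \<omega>) * step_integral z q \<omega>)"
      using ab by (intro L2_integrable_mult L2_diff z step_integral_L2[OF z q])
    moreover have "integrable L (\<lambda>\<omega>. step_integral z p \<omega> * step_integral z q \<omega>)"
      by (intro L2_integrable_mult step_integral_L2[OF z q] step_integral_L2[OF z p])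
    moreover have "(\<lambda>\<omega>. step_integral z (e # p) \<omega> * step_integral z q \<omega>) =
        (\<lambda>\<omega>. c * ((z b \<omega> - z a \<omega>) * step_integral z q \<omega>) + step_integral z p \<omega> * step_integral z q \<omega>)"
      by (simp add: e fun_eq_iff algebra_simps)
    ultimately show ?thesis by simp
  qed
  from single Cons.IH[OF p] show ?case using split[of x N, OF x] split[of y N', OF y] by simp
qed simp

lemma indicator_Ioc_L2: "indicator {0<..s} \<in> L2 (lebesgue_on {0..T::real})"
proof (rule L2_I)
  interpret finite_measure "lebesgue_on {0..T}" by (rule finite_measure_lebesgue_on) simp
  show meas: "indicator {0<..s} \<in> borel_measurable (lebesgue_on {0..T})"
    by (intro measurable_restrict_space1 measurable_completion) simp
  show "integrable (lebesgue_on {0..T}) (\<lambda>x. (indicat_real {0<..s} x)\<^sup>2)"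
  proof (rule integrable_const_bound[of _ 1])
    show "(\<lambda>x. (indicat_real {0<..s} x)\<^sup>2) \<in> borel_measurable (lebesgue_on {0..T})"
      by (rule borel_measurable_power[OF meas])
  qed (simp split: split_indicator)
qed

text \<open>The squared difference is the indicator of the interval between r and s. Its length is
  also the mean square of the Brownian increment, as the comparison in
  \<open>integral_step_integral_product_eq\<close> requires.\<close>

lemma integral_indicator_Ioc_diff_square:
  fixes r s T :: real
  assumes "r \<in> {0..T}" "s \<in> {0..T}"
  shows "(\<integral>u. (indicat_real {0<..s} u - indicat_real {0<..r} u)\<^sup>2 \<partial>lebesgue_on {0..T}) = \<bar>s - r\<bar>"
proof -
  have "(\<integral>u. (indicat_real {0<..s} u - indicat_real {0<..r} u)\<^sup>2 \<partial>lebesgue_on {0..T}) =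
      (\<integral>u. indicat_real {min r s<..max r s} u \<partial>lebesgue_on {0..T})"
    using assms by (intro Bochner_Integration.integral_cong refl) (auto simp: indicator_def)
  also have "\<dots> = measure (lebesgue_on {0..T}) ({min r s<..max r s} \<inter> {0..T})"
    by simp
  also have "{min r s<..max r s} \<inter> {0..T} = {min r s<..max r s}" using assms by auto
  also have "measure (lebesgue_on {0..T}) {min r s<..max r s} = measure lebesgue {min r s<..max r s}"
    using assms by (intro measure_restrict_space) auto
  also have "\<dots> = \<bar>s - r\<bar>" by simp
  finally show ?thesis .
qed

context prob_space
begin

lemma brownian_increment:
  assumes W: "brownian_motion T W" and st: "0 \<le> s" "s < t" "t \<le> T"
  shows "(\<lambda>\<omega>. W t \<omega> - W s \<omega>) \<in> L2 M" and "expectation (\<lambda>\<omega>. (W t \<omega> - W s \<omega>)\<^sup>2) = t - s"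
proof -
  have D: "distributed M lborel (\<lambda>\<omega>. W t \<omega> - W s \<omega>)
      (\<lambda>x. ennreal (normal_density 0 (sqrt (t - s)) x))"
    using W st unfolding brownian_motion_def by blast
  have "sqrt (t - s) > 0" using st by simp
  from normal_distributed_variance[OF this D] normal_distributed_expectation[OF this D]
  show sq: "expectation (\<lambda>\<omega>. (W t \<omega> - W s \<omega>)\<^sup>2) = t - s" using st by simp
  \<comment> \<open>A non-integrable function has Bochner integral 0 by convention, whereas the
    value here is t - s > 0.\<close>
  then have "integrable M (\<lambda>\<omega>. (W t \<omega> - W s \<omega>)\<^sup>2)"
    using st not_integrable_integral_eq by fastforce
  moreover have "(\<lambda>\<omega>. W t \<omega> - W s \<omega>) \<in> borel_measurable M"
    using distributed_measurable[OF D] by simp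
  ultimately show "(\<lambda>\<omega>. W t \<omega> - W s \<omega>) \<in> L2 M" by (intro L2_I)
qed

lemma brownian_L2:
  assumes W: "brownian_motion T W" and s: "s \<in> {0..T}"
  shows "W s \<in> L2 M"
proof (rule L2_I)
  show [measurable]: "W s \<in> borel_measurable M" using W s by (simp add: brownian_motion_def)
  have [measurable]: "W 0 \<in> borel_measurable M" using W s by (simp add: brownian_motion_def)
  have W0: "AE \<omega> in M. W 0 \<omega> = 0" using W by (simp add: brownian_motion_def)
  \<comment> \<open>Increments have a prescribed law only between distinct times, so s = 0 is
    separate. Otherwise \<open>W s\<close> agrees with \<open>W s - W 0\<close> almost surely, since
    \<open>W 0\<close> vanishes almost surely.\<close>
  show "integrable M (\<lambda>\<omega>. (W s \<omega>)\<^sup>2)"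
  proof (cases "s = 0")
    case True
    have "integrable M (\<lambda>\<omega>. (W s \<omega>)\<^sup>2) \<longleftrightarrow> integrable M (\<lambda>\<omega>. 0 :: real)"
      using W0 True by (intro integrable_cong_AE) auto
    then show ?thesis by simp
  next
    case False
    then have "integrable M (\<lambda>\<omega>. (W s \<omega> - W 0 \<omega>)\<^sup>2)"
      using s by (intro L2_integrable_square brownian_increment(1)[OF W]) auto
    also have "?this \<longleftrightarrow> ?thesis"
      using W0 by (intro integrable_cong_AE) auto
    finally show ?thesis .
  qed
qed

lemma brownian_increment_square:
  assumes W: "brownian_motion T W" and rs: "r \<in> {0..T}" "s \<in> {0..T}"
  shows "expectation (\<lambda>\<omega>. (W s \<omega> - W r \<omega>)\<^sup>2) = \<bar>s - r\<bar>"
proof -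
  consider "r < s" | "s < r" | "r = s" by linarith
  then show ?thesis
  proof cases
    case 1
    then show ?thesis using brownian_increment(2)[OF W, of r s] rs by simp
  next
    case 2
    then show ?thesis using brownian_increment(2)[OF W, of s r] rs by (simp add: power2_commute)
  qed simp
qed

lemma step_integral_isometry:
  assumes W: "brownian_motion T W" and p: "\<forall>(c, a, b)\<in>set p. 0 \<le> a \<and> a \<le> b \<and> b \<le> T"
  shows "expectation (\<lambda>\<omega>. (step_integral W p \<omega>)\<^sup>2) = (\<integral>s. (step_fun p s)\<^sup>2 \<partial>lebesgue_on {0..T})"
proof -
  note p' = step_list_endpoints[OF p]
  show ?thesis
    unfolding power2_eq_square step_fun_eq_step_integral[OF p]
    by (rule integral_step_integral_product_eq[OF brownian_L2[OF W] indicator_Ioc_L2 _ p' p'])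
      (simp_all add: brownian_increment_square[OF W] integral_indicator_Ioc_diff_square)
qed

text \<open>The same step lists approximate f and I, so the second moments, equal along the
  sequence, converge to the two sides.\<close>

lemma wiener_integral_isometry:
  assumes W: "brownian_motion T W" and I: "has_wiener_integral M T W f I"
  shows "expectation (\<lambda>\<omega>. (I \<omega>)\<^sup>2) = (\<integral>s. (f s)\<^sup>2 \<partial>lebesgue_on {0..T})"
proof -
  from I obtain p where f: "f \<in> L2 (lebesgue_on {0..T})" and IL: "I \<in> L2 M"
    and p: "\<And>m :: nat. \<forall>(c, a, b)\<in>set (p m). 0 \<le> a \<and> a \<le> b \<and> b \<le> T"
    and lim_f: "(\<lambda>m. \<integral>s. (f s - step_fun (p m) s)\<^sup>2 \<partial>lebesgue_on {0..T}) \<longlonglongrightarrow> 0"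
    and lim_I: "(\<lambda>m. \<integral>\<omega>. (I \<omega> - step_integral W (p m) \<omega>)\<^sup>2 \<partial>M) \<longlonglongrightarrow> 0"
    unfolding has_wiener_integral_def by blast
  note p' = step_list_endpoints[OF p]
  have "step_fun (p m) = step_integral (\<lambda>s. indicator {0<..s}) (p m)" for m
    using step_fun_eq_step_integral[OF p] by (simp add: fun_eq_iff)
  then have SL: "step_fun (p m) \<in> L2 (lebesgue_on {0..T})" for m
    using step_integral_L2[OF indicator_Ioc_L2 p'] by simp
  have "step_integral W (p m) \<in> L2 M" for m
    by (rule step_integral_L2[OF brownian_L2[OF W] p'])
  from L2_tendsto_integral_square[OF IL this lim_I] L2_tendsto_integral_square[OF f SL lim_f]
  show ?thesis unfolding step_integral_isometry[OF W p] by (rule LIMSEQ_unique)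
qed

end

section \<open>Differences of Wiener integrals, and their place in the linear space of the
  integrator\<close>

lemma L2_diff_square_le:
  assumes "u \<in> L2 N" "v \<in> L2 N"
  shows "(\<integral>x. (u x - v x)\<^sup>2 \<partial>N) \<le> 2 * (\<integral>x. (u x)\<^sup>2 \<partial>N) + 2 * (\<integral>x. (v x)\<^sup>2 \<partial>N)"
proof -
  have "(\<integral>x. (u x - v x)\<^sup>2 \<partial>N) \<le> (\<integral>x. 2 * (u x)\<^sup>2 + 2 * (v x)\<^sup>2 \<partial>N)"
  proof (rule integral_mono)
    show "integrable N (\<lambda>x. (u x - v x)\<^sup>2)" using L2_diff[OF assms] by (rule L2_integrable_square)
    show "integrable N (\<lambda>x. 2 * (u x)\<^sup>2 + 2 * (v x)\<^sup>2)"
      using L2_integrable_square[OF assms(1)] L2_integrable_square[OF assms(2)] by simp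
    fix x
    have "0 \<le> (u x + v x)\<^sup>2" by simp
    then show "(u x - v x)\<^sup>2 \<le> 2 * (u x)\<^sup>2 + 2 * (v x)\<^sup>2"
      by (simp add: power2_eq_square algebra_simps)
  qed
  then show ?thesis
    using L2_integrable_square[OF assms(1)] L2_integrable_square[OF assms(2)] by simp
qed

lemma L2_diff_tendsto:
  assumes L2: "u \<in> L2 N" "v \<in> L2 N" "\<And>m :: nat. u' m \<in> L2 N" "\<And>m. v' m \<in> L2 N"
    and u: "(\<lambda>m. \<integral>x. (u x - u' m x)\<^sup>2 \<partial>N) \<longlonglongrightarrow> 0"
    and v: "(\<lambda>m. \<integral>x. (v x - v' m x)\<^sup>2 \<partial>N) \<longlonglongrightarrow> 0"
  shows "(\<lambda>m. \<integral>x. ((u x - v x) - (u' m x - v' m x))\<^sup>2 \<partial>N) \<longlonglongrightarrow> 0"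
proof (rule tendsto_sandwich[OF _ _ tendsto_const])
  have "(\<integral>x. ((u x - v x) - (u' m x - v' m x))\<^sup>2 \<partial>N) \<le>
      2 * (\<integral>x. (u x - u' m x)\<^sup>2 \<partial>N) + 2 * (\<integral>x. (v x - v' m x)\<^sup>2 \<partial>N)" for m
    using L2_diff_square_le[OF L2_diff[OF L2(1) L2(3)[of m]] L2_diff[OF L2(2) L2(4)[of m]]]
    by (simp add: algebra_simps)
  then show "\<forall>\<^sub>F m in sequentially. (\<integral>x. ((u x - v x) - (u' m x - v' m x))\<^sup>2 \<partial>N) \<le>
      2 * (\<integral>x. (u x - u' m x)\<^sup>2 \<partial>N) + 2 * (\<integral>x. (v x - v' m x)\<^sup>2 \<partial>N)"
    by simp
  show "(\<lambda>m. 2 * (\<integral>x. (u x - u' m x)\<^sup>2 \<partial>N) + 2 * (\<integral>x. (v x - v' m x)\<^sup>2 \<partial>N)) \<longlonglongrightarrow> 0"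
    using tendsto_add[OF tendsto_mult_left[OF u, of 2] tendsto_mult_left[OF v, of 2]] by simp
qed simp

context prob_space
begin

lemma has_wiener_integral_diff:
  assumes W: "brownian_motion T W"
    and I: "has_wiener_integral M T W f I" and J: "has_wiener_integral M T W g J"
  shows "has_wiener_integral M T W (\<lambda>s. f s - g s) (\<lambda>\<omega>. I \<omega> - J \<omega>)"
proof -
  let ?L = "lebesgue_on {0..T}"
  let ?ok = "\<lambda>p :: (real \<times> real \<times> real) list. \<forall>(c, a, b)\<in>set p. 0 \<le> a \<and> a \<le> b \<and> b \<le> T"
  from I obtain p where f: "f \<in> L2 ?L" and IL: "I \<in> L2 M"
    and p: "\<And>m :: nat. ?ok (p m)"
    and lim_f: "(\<lambda>m. \<integral>s. (f s - step_fun (p m) s)\<^sup>2 \<partial>?L) \<longlonglongrightarrow> 0"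
    and lim_I: "(\<lambda>m. \<integral>\<omega>. (I \<omega> - step_integral W (p m) \<omega>)\<^sup>2 \<partial>M) \<longlonglongrightarrow> 0"
    unfolding has_wiener_integral_def by blast
  from J obtain q where g: "g \<in> L2 ?L" and JL: "J \<in> L2 M"
    and q: "\<And>m :: nat. ?ok (q m)"
    and lim_g: "(\<lambda>m. \<integral>s. (g s - step_fun (q m) s)\<^sup>2 \<partial>?L) \<longlonglongrightarrow> 0"
    and lim_J: "(\<lambda>m. \<integral>\<omega>. (J \<omega> - step_integral W (q m) \<omega>)\<^sup>2 \<partial>M) \<longlonglongrightarrow> 0"
    unfolding has_wiener_integral_def by blast
  \<comment> \<open>Intervals in a list may overlap, so subtraction is concatenation with negated
    coefficients.\<close>
  define r where "r m = p m @ map (\<lambda>(c, ab). (- c, ab)) (q m)" for m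
  have r: "?ok (r m)" for m using p[of m] q[of m] by (simp add: r_def ball_Un case_prod_unfold)
  have SL: "step_fun l \<in> L2 ?L" if "?ok l" for l
  proof -
    have "step_fun l = step_integral (\<lambda>s. indicator {0<..s}) l"
      using step_fun_eq_step_integral[OF that] by (simp add: fun_eq_iff)
    then show ?thesis using step_integral_L2[OF indicator_Ioc_L2 step_list_endpoints[OF that]] by simp
  qed
  have WL: "step_integral W l \<in> L2 M" if "?ok l" for l
    by (rule step_integral_L2[OF brownian_L2[OF W] step_list_endpoints[OF that]])
  have r_fun: "step_fun (r m) s = step_fun (p m) s - step_fun (q m) s" for m s
    unfolding step_fun_eq_step_integral[OF p] step_fun_eq_step_integral[OF q]
      step_fun_eq_step_integral[OF r]
    by (simp add: r_def step_integral_append step_integral_negate)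
  have r_int: "step_integral W (r m) \<omega> = step_integral W (p m) \<omega> - step_integral W (q m) \<omega>" for m \<omega>
    by (simp add: r_def step_integral_append step_integral_negate)
  show ?thesis
    unfolding has_wiener_integral_def
  proof (intro conjI exI[of _ r] allI)
    show "(\<lambda>s. f s - g s) \<in> L2 ?L" "(\<lambda>\<omega>. I \<omega> - J \<omega>) \<in> L2 M"
      using f g IL JL by (auto intro: L2_diff)
    show "?ok (r m)" for m by (rule r)
    show "(\<lambda>m. \<integral>s. (f s - g s - step_fun (r m) s)\<^sup>2 \<partial>?L) \<longlonglongrightarrow> 0"
      unfolding r_fun using f g SL[OF p] SL[OF q] lim_f lim_g by (rule L2_diff_tendsto)
    show "(\<lambda>m. \<integral>\<omega>. (I \<omega> - J \<omega> - step_integral W (r m) \<omega>)\<^sup>2 \<partial>M) \<longlonglongrightarrow> 0"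
      unfolding r_int using IL JL WL[OF p] WL[OF q] lim_I lim_J by (rule L2_diff_tendsto)
  qed
qed

end

text \<open>On the family of point indicators, a step integral evaluated at s returns the net
  coefficient of \<open>x s\<close>. This turns sums of increments into the combinations of values
  that \<open>lin_space\<close> asks for.\<close>

lemma step_integral_eq_sum:
  assumes "finite S" and "\<forall>(c, a, b)\<in>set p. a \<in> S \<and> b \<in> S"
  shows "step_integral x p \<omega> = (\<Sum>s\<in>S. step_integral (\<lambda>r. indicator {r}) p s * x s \<omega>)"
  using assms(2)
proof (induction p)
  case (Cons e p)
  obtain c a b where e: "e = (c, a, b)" by (rule prod_cases3)
  have "a \<in> S" "b \<in> S" and p: "\<forall>(c, a, b)\<in>set p. a \<in> S \<and> b \<in> S" using Cons.prems e by auto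
  have pick: "(\<Sum>s\<in>S. indicator {r} s * x s \<omega>) = x r \<omega>" if "r \<in> S" for r
  proof -
    have "(\<Sum>s\<in>S. indicator {r} s * x s \<omega>) = (\<Sum>s\<in>S. if s = r then x s \<omega> else 0)"
      by (intro sum.cong) (auto simp: indicator_def)
    then show ?thesis using assms(1) that by simp
  qed
  have "(\<Sum>s\<in>S. step_integral (\<lambda>r. indicator {r}) (e # p) s * x s \<omega>) =
      (\<Sum>s\<in>S. c * (indicator {b} s * x s \<omega>) - c * (indicator {a} s * x s \<omega>)
        + step_integral (\<lambda>r. indicator {r}) p s * x s \<omega>)"
    by (intro sum.cong refl) (simp only: e step_integral_Cons, simp only: ring_distribs mult.assoc)
  also have "\<dots> = c * x b \<omega> - c * x a \<omega> + step_integral x p \<omega>"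
    by (simp only: sum.distrib sum_subtractf sum_distrib_left[symmetric]
        pick[OF \<open>a \<in> S\<close>] pick[OF \<open>b \<in> S\<close>] Cons.IH[OF p, symmetric])
  finally show ?case by (simp only: e step_integral_Cons right_diff_distrib)
qed simp

lemma wiener_integral_in_lin_space:
  assumes I: "has_wiener_integral M T W f I"
  shows "I \<in> lin_space M W T"
  unfolding lin_space_def
proof (intro CollectI conjI allI impI)
  from I obtain p where IL: "I \<in> L2 M"
    and p: "\<And>m :: nat. \<forall>(c, a, b)\<in>set (p m). 0 \<le> a \<and> a \<le> b \<and> b \<le> T"
    and lim: "(\<lambda>m. \<integral>\<omega>. (I \<omega> - step_integral W (p m) \<omega>)\<^sup>2 \<partial>M) \<longlonglongrightarrow> 0"
    unfolding has_wiener_integral_def by blast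
  show "I \<in> L2 M" by (rule IL)
  fix e :: real assume "e > 0"
  have "\<exists>m. (\<integral>\<omega>. (I \<omega> - step_integral W (p m) \<omega>)\<^sup>2 \<partial>M) < e"
    by (rule eventually_happens'[OF sequentially_bot order_tendstoD(2)[OF lim \<open>e > 0\<close>]])
  then obtain m where m: "(\<integral>\<omega>. (I \<omega> - step_integral W (p m) \<omega>)\<^sup>2 \<partial>M) < e" ..
  define S where "S = (\<lambda>(c, a, b). a) ` set (p m) \<union> (\<lambda>(c, a, b). b) ` set (p m)"
  have S: "finite S" "\<forall>(c, a, b)\<in>set (p m). a \<in> S \<and> b \<in> S"
    by (force simp: S_def)+
  have "S \<subseteq> {0..T}"
    using step_list_endpoints[OF p[of m]] by (auto simp: S_def)
  define k where "k = step_integral (\<lambda>r. indicat_real {r}) (p m)"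
  have "step_integral W (p m) \<omega> = (\<Sum>s\<in>S. k s * W s \<omega>)" for \<omega>
    unfolding k_def by (rule step_integral_eq_sum[OF S])
  with m S(1) \<open>S \<subseteq> {0..T}\<close> show "\<exists>S c. finite S \<and> S \<subseteq> {0..T} \<and> (\<integral>\<omega>. (I \<omega> - (\<Sum>s\<in>S. c s * W s \<omega>))\<^sup>2 \<partial>M) < e"
    by (intro exI[of _ S] exI[of _ k]) simp
qed

section \<open>Conditional expectation given an independent remainder\<close>

text \<open>By independence the map \<omega> -> (\<omega>, R \<omega>) carries M to the product of
  the restriction of M to F and the law of R. Fubini's theorem then freezes V and integrates R
  out.\<close>

lemma (in prob_space) real_cond_exp_indep_shift:
  fixes R V :: "'a \<Rightarrow> real" and h :: "real \<Rightarrow> real"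
  assumes F: "subalgebra M F"
    and R [measurable]: "random_variable borel R"
    and V: "V \<in> borel_measurable F" and h [measurable]: "h \<in> borel_measurable borel"
    and indep: "\<And>A B. A \<in> sets F \<Longrightarrow> B \<in> sets borel \<Longrightarrow>
      prob (A \<inter> (R -` B \<inter> space M)) = prob A * prob (R -` B \<inter> space M)"
    and int: "integrable M (\<lambda>\<omega>. h (V \<omega> + R \<omega>))"
  shows "AE \<omega> in M. integrable (distr M borel R) (\<lambda>r. h (V \<omega> + r)) \<and>
    real_cond_exp M F (\<lambda>\<omega>. h (V \<omega> + R \<omega>)) \<omega> = (\<integral>r. h (V \<omega> + r) \<partial>distr M borel R)"
proof -
  define N where "N = restr_to_subalg M F"
  define \<nu> where "\<nu> = distr M borel R"
  interpret N: prob_space N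
    unfolding N_def using F prob_space_axioms by (rule prob_space_restr_to_subalg)
  interpret \<nu>: prob_space \<nu> unfolding \<nu>_def by (rule prob_space_distr) simp
  interpret pair_sigma_finite N \<nu> ..
  interpret finite_measure_subalgebra M F by unfold_locales (rule F)
  have sets_N: "sets N = sets F" unfolding N_def by (rule sets_restr_to_subalg[OF F])
  have space_F: "space F = space M" using F by (auto simp: subalgebra_def)
  have id: "(\<lambda>\<omega>. \<omega>) \<in> measurable M N"
    by (rule measurable_from_subalg[OF F measurable_ident_sets[OF sets_N[symmetric]]])
  \<comment> \<open>The whole point \<omega>, and not just \<open>V \<omega>\<close>, is the first
    coordinate, so that every set of F is visible in the product.\<close>
  have pair: "(\<lambda>\<omega>. (\<omega>, R \<omega>)) \<in> measurable M (N \<Otimes>\<^sub>M borel)"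
    using id by (intro measurable_Pair) auto
  have VN [measurable]: "V \<in> borel_measurable N"
    unfolding N_def by (rule measurable_in_subalg[OF F V])
  have joint: "N \<Otimes>\<^sub>M \<nu> = distr M (N \<Otimes>\<^sub>M borel) (\<lambda>\<omega>. (\<omega>, R \<omega>))"
  proof (rule pair_measure_eqI)
    show "sigma_finite_measure N" "sigma_finite_measure \<nu>" by unfold_locales
    show "sets (N \<Otimes>\<^sub>M \<nu>) = sets (distr M (N \<Otimes>\<^sub>M borel) (\<lambda>\<omega>. (\<omega>, R \<omega>)))"
      unfolding sets_distr by (rule sets_pair_measure_cong) (simp_all add: \<nu>_def)
    fix A B assume A: "A \<in> sets N" and "B \<in> sets \<nu>"
    then have B: "B \<in> sets borel" by (simp add: \<nu>_def)
    have AF: "A \<in> sets F" using A sets_N by simp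
    then have "A \<subseteq> space M" using sets.sets_into_space space_F by blast
    have "emeasure N A = prob A"
      using emeasure_restr_to_subalg[OF F AF] by (simp add: N_def emeasure_eq_measure)
    moreover have "emeasure \<nu> B = prob (R -` B \<inter> space M)"
      using B by (simp add: \<nu>_def emeasure_distr emeasure_eq_measure)
    moreover have "emeasure (distr M (N \<Otimes>\<^sub>M borel) (\<lambda>\<omega>. (\<omega>, R \<omega>))) (A \<times> B) =
        prob (A \<inter> (R -` B \<inter> space M))"
    proof -
      have "(\<lambda>\<omega>. (\<omega>, R \<omega>)) -` (A \<times> B) \<inter> space M = A \<inter> (R -` B \<inter> space M)"
        using \<open>A \<subseteq> space M\<close> by auto
      then show ?thesis
        using A B by (simp add: emeasure_distr[OF pair] emeasure_eq_measure)
    qed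
    ultimately show "emeasure N A * emeasure \<nu> B =
        emeasure (distr M (N \<Otimes>\<^sub>M borel) (\<lambda>\<omega>. (\<omega>, R \<omega>))) (A \<times> B)"
      using indep[OF AF B] by (simp add: ennreal_mult)
  qed
  define g where "g \<omega> = (\<integral>r. h (V \<omega> + r) \<partial>\<nu>)" for \<omega>
  have int_joint: "integrable (N \<Otimes>\<^sub>M \<nu>) (\<lambda>(\<omega>, r). h (V \<omega> + r))"
    unfolding joint using int by (subst integrable_distr_eq[OF pair]) simp_all
  have g_int: "integrable N g"
    using integrable_fst'[OF int_joint] by (simp add: g_def[abs_def])
  have g_meas: "g \<in> borel_measurable F"
    using g_int by (intro measurable_in_subalg'[OF F]) (auto simp: N_def)
  have "AE \<omega> in M. real_cond_exp M F (\<lambda>\<omega>. h (V \<omega> + R \<omega>)) \<omega> = g \<omega>"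
  proof (rule real_cond_exp_charact[OF _ int _ g_meas])
    show "integrable M g"
      using g_int unfolding N_def by (rule integrable_from_subalg[OF F])
    fix A assume A: "A \<in> sets F"
    have AN [measurable]: "A \<in> sets N" using A sets_N by simp
    have int_A: "integrable (N \<Otimes>\<^sub>M \<nu>) (\<lambda>x. indicator A (fst x) * h (V (fst x) + snd x))"
      using int_joint
    proof (rule Bochner_Integration.integrable_bound)
      show "(\<lambda>x. indicator A (fst x) * h (V (fst x) + snd x)) \<in> borel_measurable (N \<Otimes>\<^sub>M \<nu>)"
        unfolding \<nu>_def by measurable
    qed (auto split: split_indicator)
    have "(\<integral>\<omega>\<in>A. h (V \<omega> + R \<omega>) \<partial>M) = (\<integral>\<omega>. indicator A \<omega> * h (V \<omega> + R \<omega>) \<partial>M)"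
      by (simp add: set_lebesgue_integral_def)
    also have "\<dots> = (\<integral>x. indicator A (fst x) * h (V (fst x) + snd x) \<partial>(N \<Otimes>\<^sub>M \<nu>))"
      unfolding joint by (subst integral_distr[OF pair]) simp_all
    also have "\<dots> = (\<integral>\<omega>. (\<integral>r. indicator A \<omega> * h (V \<omega> + r) \<partial>\<nu>) \<partial>N)"
      using integral_fst'[OF int_A] by simp
    also have "\<dots> = (\<integral>\<omega>. indicator A \<omega> * g \<omega> \<partial>N)"
      by (simp add: g_def)
    also have "\<dots> = (\<integral>\<omega>. indicator A \<omega> * g \<omega> \<partial>M)"
      unfolding N_def using A g_meas by (intro integral_subalgebra2[OF F]) simp
    also have "\<dots> = (\<integral>\<omega>\<in>A. g \<omega> \<partial>M)"
      by (simp add: set_lebesgue_integral_def)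
    finally show "(\<integral>\<omega>\<in>A. h (V \<omega> + R \<omega>) \<partial>M) = (\<integral>\<omega>\<in>A. g \<omega> \<partial>M)" .
  qed
  \<comment> \<open>Fubini's theorem also makes almost every section integrable, so that g is a
    genuine integral there and not the default value 0.\<close>
  moreover have "AE \<omega> in M. integrable \<nu> (\<lambda>r. h (V \<omega> + r))"
    using AE_integrable_fst'[OF int_joint] unfolding N_def
    by (intro AE_restr_to_subalg[OF F]) simp
  ultimately show ?thesis by (auto simp: g_def \<nu>_def)
qed

text \<open>Both laws have the same characteristic function. An image law, unlike a density,
  includes \<open>\<rho> = 0\<close>, the case of perfect prediction, where the law is the point
  mass at 0.\<close>

lemma (in prob_space) distr_eq_scaled_std_normal:
  assumes R [measurable]: "random_variable borel R"
    and char_R: "\<And>u. (CLINT \<omega>|M. iexp (u * R \<omega>)) = complex_of_real (exp (- (u\<^sup>2 * \<rho> / 2)))"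
    and "\<rho> \<ge> 0"
  shows "distr M borel R = distr std_normal_distribution borel (\<lambda>z. z * sqrt \<rho>)"
proof (rule Levy_uniqueness)
  interpret S: real_distribution std_normal_distribution by (rule real_dist_normal_dist)
  show "real_distribution (distr M borel R)" by simp
  show "real_distribution (distr std_normal_distribution borel (\<lambda>z. z * sqrt \<rho>))" by simp
  show "char (distr M borel R) = char (distr std_normal_distribution borel (\<lambda>z. z * sqrt \<rho>))"
  proof
    fix u
    have "char (distr std_normal_distribution borel (\<lambda>z. z * sqrt \<rho>)) u =
        (CLINT z|std_normal_distribution. iexp (u * (z * sqrt \<rho>)))"
      unfolding char_def by (rule integral_distr) auto
    also have "\<dots> = char std_normal_distribution (u * sqrt \<rho>)"
      unfolding char_def by (simp only: mult_ac)
    also have "\<dots> = complex_of_real (exp (- (u\<^sup>2 * \<rho> / 2)))"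
      using \<open>\<rho> \<ge> 0\<close> by (simp add: char_std_normal_distribution power_mult_distrib)
    also have "\<dots> = char (distr M borel R) u"
      unfolding char_def char_R[symmetric] by (rule integral_distr[symmetric]) auto
    finally show "char (distr M borel R) u =
        char (distr std_normal_distribution borel (\<lambda>z. z * sqrt \<rho>)) u" ..
  qed
qed

section \<open>Sigma algebras of transformed processes\<close>

text \<open>Taking compact subsets of the graph of \<open>g\<close> avoids the Lusin-Souslin theorem: the projection of a
  compact set is compact, and the injectivity of \<open>g\<close> identifies its preimage.\<close>

lemma (in prob_space) ex_borel_preimage_inj:
  fixes U :: "'a \<Rightarrow> real" and g :: "real \<Rightarrow> real"
  assumes U [measurable]: "random_variable borel U" and g [measurable]: "g \<in> borel_measurable borel"
    and inj: "inj g" and B [measurable]: "B \<in> sets borel"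
  shows "\<exists>C\<in>sets borel. AE \<omega> in M. U \<omega> \<in> B \<longleftrightarrow> g (U \<omega>) \<in> C"
proof -
  define \<nu> where "\<nu> = distr M borel (\<lambda>\<omega>. (U \<omega>, g (U \<omega>)))"
  have UgU [measurable]: "(\<lambda>\<omega>. (U \<omega>, g (U \<omega>))) \<in> borel_measurable M" by measurable
  interpret \<nu>: prob_space \<nu> unfolding \<nu>_def by (rule prob_space_distr) simp
  define G where "G = {x :: real \<times> real. fst x \<in> B \<and> snd x = g (fst x)}"
  have G: "G \<in> sets borel"
  proof -
    have "Measurable.pred borel (\<lambda>x :: real \<times> real. fst x \<in> B \<and> snd x = g (fst x))"
      unfolding borel_prod[symmetric] by measurable
    then show ?thesis by (simp add: G_def pred_def)
  qed
  have sets_\<nu>: "sets \<nu> = sets borel" by (simp add: \<nu>_def)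
  have "{} \<in> {K. K \<subseteq> G \<and> compact K}" by simp
  then have "{K. K \<subseteq> G \<and> compact K} \<noteq> {}" by blast
  \<comment> \<open>The supremum in inner regularity is already that of a countable subfamily, so
    countably many compact sets fill G up to a null set.\<close>
  from ennreal_SUP_countable_SUP[OF this, of "emeasure \<nu>"]
  obtain m :: "nat \<Rightarrow> ennreal" where m: "range m \<subseteq> emeasure \<nu> ` {K. K \<subseteq> G \<and> compact K}"
    "(SUP K\<in>{K. K \<subseteq> G \<and> compact K}. emeasure \<nu> K) = Sup (range m)" by blast
  have "\<forall>i. \<exists>K. K \<subseteq> G \<and> compact K \<and> m i = emeasure \<nu> K" using m(1) by blast
  from choice[OF this] obtain K where K: "\<And>i. K i \<subseteq> G" "\<And>i. compact (K i)"
    "\<And>i. m i = emeasure \<nu> (K i)" by blast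
  define L where "L = (\<Union>i. K i)"
  have K_borel: "K i \<in> sets borel" for i using K(2)[of i] by (intro borel_closed compact_imp_closed)
  then have L_borel: "L \<in> sets borel" unfolding L_def by blast
  have "L \<subseteq> G" using K(1) by (auto simp: L_def)
  have "emeasure \<nu> G = (SUP K\<in>{K. K \<subseteq> G \<and> compact K}. emeasure \<nu> K)"
    by (rule inner_regular[OF sets_\<nu> _ G]) simp
  also have "\<dots> = (SUP i. emeasure \<nu> (K i))" using m(2) K(3) by simp
  also have "\<dots> \<le> emeasure \<nu> L"
    using L_borel by (intro SUP_least emeasure_mono) (auto simp: L_def sets_\<nu>)
  finally have "emeasure \<nu> G \<le> emeasure \<nu> L" .
  moreover have "emeasure \<nu> (G - L) = emeasure \<nu> G - emeasure \<nu> L"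
    using \<open>L \<subseteq> G\<close> G L_borel by (intro emeasure_Diff) (auto simp: sets_\<nu>)
  ultimately have "emeasure \<nu> (G - L) = 0"
    by (simp add: diff_eq_0_iff_ennreal less_top[symmetric])
  then have "G - L \<in> null_sets \<nu>" using G L_borel by (auto simp: null_sets_def sets_\<nu>)
  then have "AE x in \<nu>. x \<notin> G - L" by (rule AE_not_in)
  then have ae: "AE \<omega> in M. (U \<omega>, g (U \<omega>)) \<notin> G - L"
    unfolding \<nu>_def by (rule AE_distrD[rotated]) simp
  define C where "C = (\<Union>i. snd ` K i)"
  have "snd ` K i \<in> sets borel" for i
    using K(2)[of i]
    by (intro borel_closed compact_imp_closed compact_continuous_image continuous_on_snd continuous_on_id)
  then have "C \<in> sets borel" unfolding C_def by blast
  moreover have "AE \<omega> in M. U \<omega> \<in> B \<longleftrightarrow> g (U \<omega>) \<in> C"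
    using ae
  proof eventually_elim
    fix \<omega> assume *: "(U \<omega>, g (U \<omega>)) \<notin> G - L"
    show "U \<omega> \<in> B \<longleftrightarrow> g (U \<omega>) \<in> C"
    proof
      assume "U \<omega> \<in> B"
      then have "(U \<omega>, g (U \<omega>)) \<in> L" using * by (simp add: G_def)
      then obtain i where "(U \<omega>, g (U \<omega>)) \<in> K i" unfolding L_def by blast
      then show "g (U \<omega>) \<in> C" unfolding C_def by force
    next
      assume "g (U \<omega>) \<in> C"
      then obtain i x where x: "x \<in> K i" "g (U \<omega>) = snd x" unfolding C_def by blast
      then have "x \<in> G" using K(1) by blast
      then have "fst x \<in> B" "g (U \<omega>) = g (fst x)" using x(2) by (auto simp: G_def)
      then show "U \<omega> \<in> B" using injD[OF inj] by metis
    qed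
  qed
  ultimately show ?thesis by blast
qed

text \<open>The sets that agree almost surely with one from the transformed sigma algebra form a
  sigma algebra, and \<open>ex_borel_preimage_inj\<close> puts the generators into it. The
  exceptional null set may depend on A; hence only countable unions of null sets occur, although
  there may be uncountably many times.\<close>

lemma (in prob_space) ex_sigma_gen_transform:
  fixes Z :: "real \<Rightarrow> 'a \<Rightarrow> real" and g :: "real \<Rightarrow> real \<Rightarrow> real"
  assumes Z: "\<And>s. s \<in> D \<Longrightarrow> random_variable borel (Z s)"
    and g: "\<And>s. s \<in> D \<Longrightarrow> g s \<in> borel_measurable borel" "\<And>s. s \<in> D \<Longrightarrow> inj (g s)"
    and A: "A \<in> sets (sigma_gen M Z D)"
  shows "\<exists>A'\<in>sets (sigma_gen M (\<lambda>s \<omega>. g s (Z s \<omega>)) D). AE \<omega> in M. \<omega> \<in> A \<longleftrightarrow> \<omega> \<in> A'"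
  using A unfolding sets_sigma_gen[of M Z]
proof (induction rule: sigma_sets.induct)
  case (Basic A)
  then obtain s B where A: "A = Z s -` B \<inter> space M" and s: "s \<in> D" and B: "B \<in> sets borel" by blast
  obtain C where C: "C \<in> sets borel" "AE \<omega> in M. Z s \<omega> \<in> B \<longleftrightarrow> g s (Z s \<omega>) \<in> C"
    using ex_borel_preimage_inj[OF Z g(1) g(2) B] s by blast
  let ?A = "(\<lambda>\<omega>. g s (Z s \<omega>)) -` C \<inter> space M"
  have "?A \<in> sets (sigma_gen M (\<lambda>s \<omega>. g s (Z s \<omega>)) D)"
    unfolding sets_sigma_gen using s C(1) by (intro sigma_sets.Basic) blast
  moreover have "AE \<omega> in M. \<omega> \<in> A \<longleftrightarrow> \<omega> \<in> ?A"
    using C(2) by eventually_elim (auto simp: A)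
  ultimately show ?case by blast
next
  case Empty
  then show ?case by (intro bexI[of _ "{}"]) auto
next
  case (Compl A)
  then obtain A' where A': "A' \<in> sets (sigma_gen M (\<lambda>s \<omega>. g s (Z s \<omega>)) D)"
    "AE \<omega> in M. \<omega> \<in> A \<longleftrightarrow> \<omega> \<in> A'" by blast
  have "space M - A' \<in> sets (sigma_gen M (\<lambda>s \<omega>. g s (Z s \<omega>)) D)"
    using sets.compl_sets[OF A'(1)] by simp
  moreover have "AE \<omega> in M. \<omega> \<in> space M - A \<longleftrightarrow> \<omega> \<in> space M - A'"
    using A'(2) by eventually_elim auto
  ultimately show ?case by blast
next
  case (Union A)
  then have "\<forall>i. \<exists>A'. A' \<in> sets (sigma_gen M (\<lambda>s \<omega>. g s (Z s \<omega>)) D) \<and>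
    (AE \<omega> in M. \<omega> \<in> A i \<longleftrightarrow> \<omega> \<in> A')" by blast
  from choice[OF this] obtain A' where A': "\<forall>i. A' i \<in> sets (sigma_gen M (\<lambda>s \<omega>. g s (Z s \<omega>)) D) \<and>
    (AE \<omega> in M. \<omega> \<in> A i \<longleftrightarrow> \<omega> \<in> A' i)" ..
  have "(\<Union>i. A' i) \<in> sets (sigma_gen M (\<lambda>s \<omega>. g s (Z s \<omega>)) D)" using A' by blast
  moreover have "AE \<omega> in M. \<forall>i. \<omega> \<in> A i \<longleftrightarrow> \<omega> \<in> A' i" using A' by (simp add: AE_all_countable)
  then have "AE \<omega> in M. \<omega> \<in> (\<Union>i. A i) \<longleftrightarrow> \<omega> \<in> (\<Union>i. A' i)"
    by eventually_elim auto
  ultimately show ?case by blast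
qed

text \<open>The conditional expectation given F' also satisfies the characterisation for F: it is
  measurable for the larger F, and integrals over A equal those over its almost sure copy
  A'.\<close>

lemma (in prob_space) real_cond_exp_eq_if_AE_eq_sets:
  assumes F: "subalgebra M F" and F': "subalgebra M F'" and sub: "sets F' \<subseteq> sets F"
    and approx: "\<And>A. A \<in> sets F \<Longrightarrow> \<exists>A'\<in>sets F'. AE \<omega> in M. \<omega> \<in> A \<longleftrightarrow> \<omega> \<in> A'"
    and V: "integrable M V"
  shows "AE \<omega> in M. real_cond_exp M F V \<omega> = real_cond_exp M F' V \<omega>"
proof -
  interpret F: finite_measure_subalgebra M F by unfold_locales (rule F)
  interpret F': finite_measure_subalgebra M F' by unfold_locales (rule F')
  have int: "integrable M (real_cond_exp M F' V)" by (rule F'.real_cond_exp_int(1)[OF V])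
  show ?thesis
  proof (rule F.real_cond_exp_charact[OF _ V int])
    show "real_cond_exp M F' V \<in> borel_measurable F"
    proof (rule measurable_from_subalg)
      show "subalgebra F F'" using F F' sub by (auto simp: subalgebra_def)
    qed simp
    fix A assume A: "A \<in> sets F"
    obtain A' where A': "A' \<in> sets F'" and ae: "AE \<omega> in M. \<omega> \<in> A \<longleftrightarrow> \<omega> \<in> A'"
      using approx[OF A] by blast
    have [measurable]: "A \<in> sets M" "A' \<in> sets M"
      using A A' F F' by (auto simp: subalgebra_def)
    have swap: "(\<integral>\<omega>\<in>A. U \<omega> \<partial>M) = (\<integral>\<omega>\<in>A'. U \<omega> \<partial>M)" if "integrable M U" for U :: "'a \<Rightarrow> real"
    proof -
      have [measurable]: "U \<in> borel_measurable M" using that by simp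
      show ?thesis unfolding set_lebesgue_integral_def
        using ae by (intro integral_cong_AE) (auto split: split_indicator)
    qed
    show "(\<integral>\<omega>\<in>A. V \<omega> \<partial>M) = (\<integral>\<omega>\<in>A. real_cond_exp M F' V \<omega> \<partial>M)"
      unfolding swap[OF V] swap[OF int] by (rule F'.real_cond_exp_intA[OF V A'])
  qed
qed

lemma sets_sigma_gen_transform_subset:
  assumes "\<And>s. s \<in> D \<Longrightarrow> g s \<in> borel_measurable borel"
  shows "sets (sigma_gen M (\<lambda>s \<omega>. g s (Z s \<omega>)) D) \<subseteq> sets (sigma_gen M Z D)"
  unfolding sets_sigma_gen
proof (rule sigma_sets_subseteq, safe)
  fix s and B :: "real set" assume s: "s \<in> D" and B: "B \<in> sets borel"
  have "g s -` B \<in> sets borel" using measurable_sets[OF assms[OF s] B] by simp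
  then show "\<exists>t B'. (\<lambda>\<omega>. g s (Z s \<omega>)) -` B \<inter> space M = Z t -` B' \<inter> space M \<and> t \<in> D \<and> B' \<in> sets borel"
    using s by (intro exI[of _ s] exI[of _ "g s -` B"]) auto
qed

section \<open>Prediction of the transformed process\<close>

lemma observed_subset:
  assumes "interval_system T n tL tU"
  shows "observed n tL tU \<subseteq> {0..T}"
proof
  have len: "\<And>k. 1 \<le> k \<Longrightarrow> k \<le> n \<Longrightarrow> tL k < tU k"
    and gap: "\<And>k. 1 \<le> k \<Longrightarrow> k < n \<Longrightarrow> tU k < tL (Suc k)"
    and ends: "0 \<le> tL 1" "tU n \<le> T"
    using assms by (auto simp: interval_system_def)
  have lower: "tL 1 \<le> tL k" if "1 \<le> k" "k \<le> n" for k
    using that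
  proof (induction k rule: dec_induct)
    case (step k)
    then show ?case using len[of k] gap[of k] by simp
  qed simp
  have upper: "tU k \<le> tU n" if "k \<le> n" "1 \<le> k" for k
    using that
  proof (induction k rule: inc_induct)
    case (step k)
    then show ?case using len[of "Suc k"] gap[of k] by simp
  qed simp
  fix u assume "u \<in> observed n tL tU"
  then obtain k where "1 \<le> k" "k \<le> n" "tL k \<le> u" "u \<le> tU k" by (auto simp: observed_def)
  with lower[of k] upper[of k] ends show "u \<in> {0..T}" by auto
qed

context fredholm_gaussian_process
begin

lemma X_L2: "s \<in> {0..T} \<Longrightarrow> X s \<in> L2 M"
  using fredholm by (auto simp: has_wiener_integral_def)

lemma X_measurable: "s \<in> {0..T} \<Longrightarrow> random_variable borel (X s)"
  by (rule L2_measurable[OF X_L2])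

lemma lin_space_X_integral_iexp:
  assumes "U \<in> lin_space M X T"
  shows "(CLINT \<omega>|M. iexp (u * U \<omega>)) =
    complex_of_real (exp (- (u\<^sup>2 * expectation (\<lambda>\<omega>. (U \<omega>)\<^sup>2) / 2)))"
  by (rule lin_space_integral_iexp[OF gaussian X_L2 _ assms]) (use centered in auto)

text \<open>Without covariance the variance of u R + V is a sum, so the Gaussian exponentials
  multiply. It matters that R and V lie in one linear space, which makes the sum Gaussian; Gaussian
  marginals alone would not allow the conclusion.\<close>

lemma indep_of_uncorrelated:
  assumes D: "D \<subseteq> {0..T}" and R: "R \<in> lin_space M X T"
    and uncorrelated: "\<And>s. s \<in> D \<Longrightarrow> expectation (\<lambda>\<omega>. R \<omega> * X s \<omega>) = 0"
    and A: "A \<in> sets (sigma_gen M X D)" and B: "B \<in> sets borel"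
  shows "prob (A \<inter> (R -` B \<inter> space M)) = prob A * prob (R -` B \<inter> space M)"
proof (rule prob_Int_vimage_sigma_gen[OF _ _ _ A B])
  have RL: "R \<in> L2 M" using R by (simp add: lin_space_def)
  then show "random_variable borel R" by (rule L2_measurable)
  show "random_variable borel (X s)" if "s \<in> D" for s
    using that D by (intro X_measurable) auto
  fix S and c :: "real \<Rightarrow> real" and u assume S: "finite S" "S \<subseteq> D"
  define V where "V \<omega> = (\<Sum>s\<in>S. c s * X s \<omega>)" for \<omega>
  have S_sub: "s \<in> {0..T}" if "s \<in> S" for s using that S D by blast
  have V: "V \<in> lin_space M X T"
    unfolding V_def using S_sub
    by (intro lin_space_sum X_L2 lin_space_base) auto
  then have VL: "V \<in> L2 M" by (simp add: lin_space_def)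
  have "integrable M (\<lambda>\<omega>. R \<omega> * X s \<omega>)" if "s \<in> S" for s
    using that by (intro L2_integrable_mult RL X_L2 S_sub)
  moreover have "(\<lambda>\<omega>. R \<omega> * V \<omega>) = (\<lambda>\<omega>. \<Sum>s\<in>S. c s * (R \<omega> * X s \<omega>))"
    by (simp add: V_def sum_distrib_left mult_ac)
  ultimately have "expectation (\<lambda>\<omega>. R \<omega> * V \<omega>) = (\<Sum>s\<in>S. c s * expectation (\<lambda>\<omega>. R \<omega> * X s \<omega>))"
    by (simp add: Bochner_Integration.integral_sum)
  also have "\<dots> = 0" using uncorrelated S by (intro sum.neutral) auto
  finally have RV: "expectation (\<lambda>\<omega>. R \<omega> * V \<omega>) = 0" .
  \<comment> \<open>The factor 1 matches the form in \<open>lin_space_lincomb\<close>. The frequency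
    u is part of the combination, so its characteristic function is needed only at 1.\<close>
  have "(\<lambda>\<omega>. (u * R \<omega> + 1 * V \<omega>)\<^sup>2) = (\<lambda>\<omega>. u\<^sup>2 * (R \<omega>)\<^sup>2 + (V \<omega>)\<^sup>2 + 2 * u * (R \<omega> * V \<omega>))"
    by (simp add: fun_eq_iff power2_eq_square algebra_simps)
  then have var: "expectation (\<lambda>\<omega>. (u * R \<omega> + 1 * V \<omega>)\<^sup>2) =
      u\<^sup>2 * expectation (\<lambda>\<omega>. (R \<omega>)\<^sup>2) + expectation (\<lambda>\<omega>. (V \<omega>)\<^sup>2)"
    using L2_integrable_square[OF RL] L2_integrable_square[OF VL] L2_integrable_mult[OF RL VL] RV
    by simp
  have RV_lin: "(\<lambda>\<omega>. u * R \<omega> + 1 * V \<omega>) \<in> lin_space M X T"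
    using X_L2 R V by (rule lin_space_lincomb)
  have "(CLINT \<omega>|M. iexp (u * R \<omega> + V \<omega>)) = complex_of_real
      (exp (- ((u\<^sup>2 * expectation (\<lambda>\<omega>. (R \<omega>)\<^sup>2) + expectation (\<lambda>\<omega>. (V \<omega>)\<^sup>2)) / 2)))"
    using lin_space_X_integral_iexp[OF RV_lin, of 1] unfolding var by (simp only: mult_1 one_power2)
  also have "\<dots> = (CLINT \<omega>|M. iexp (u * R \<omega>)) * (CLINT \<omega>|M. iexp (V \<omega>))"
    using lin_space_X_integral_iexp[OF R, of u] lin_space_X_integral_iexp[OF V, of 1]
    by (simp only: mult_1 one_power2 of_real_mult[symmetric] exp_add[symmetric])
      (simp add: add_divide_distrib)
  finally show "(CLINT \<omega>|M. iexp (u * R \<omega> + (\<Sum>s\<in>S. c s * X s \<omega>))) =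
      (CLINT \<omega>|M. iexp (u * R \<omega>)) * (CLINT \<omega>|M. iexp (\<Sum>s\<in>S. c s * X s \<omega>))"
    by (simp only: V_def)
qed

lemma real_cond_exp_transform:
  fixes h :: "real \<Rightarrow> real"
  assumes D: "D \<subseteq> {0..T}" and t: "t \<in> {0..T}"
    and ft: "has_wiener_integral M T W ft (real_cond_exp M (sigma_gen M X D) (X t))"
    and h [measurable]: "h \<in> borel_measurable borel" and int: "integrable M (\<lambda>\<omega>. h (X t \<omega>))"
  defines "Xhat \<equiv> real_cond_exp M (sigma_gen M X D) (X t)"
    and "\<rho> \<equiv> (\<integral>u. (K t u - ft u)\<^sup>2 \<partial>lebesgue_on {0..T})"
  shows "AE \<omega> in M. integrable lborel (\<lambda>z. h (Xhat \<omega> + z * sqrt \<rho>) * std_normal_density z) \<and>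
    real_cond_exp M (sigma_gen M X D) (\<lambda>\<omega>. h (X t \<omega>)) \<omega> =
      (\<integral>z. h (Xhat \<omega> + z * sqrt \<rho>) * std_normal_density z \<partial>lborel)"
proof -
  define F where "F = sigma_gen M X D"
  have XD: "random_variable borel (X s)" if "s \<in> D" for s
    using that D by (intro X_measurable) auto
  have F: "subalgebra M F" unfolding F_def by (rule subalgebra_sigma_gen[OF XD])
  interpret F: finite_measure_subalgebra M F by unfold_locales (rule F)
  define R where "R \<omega> = X t \<omega> - Xhat \<omega>" for \<omega>
  have Xhat: "has_wiener_integral M T W ft Xhat" using ft by (simp add: Xhat_def)
  have XhatL: "Xhat \<in> L2 M" using Xhat by (simp add: has_wiener_integral_def)
  \<comment> \<open>The residual is the Wiener integral of \<open>K t - ft\<close>: this yields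
    membership in the linear space of W, hence of X, and through the isometry the variance
    \<open>\<rho>\<close>.\<close>
  have R_int: "has_wiener_integral M T W (\<lambda>s. K t s - ft s) R"
    unfolding R_def using fredholm t Xhat by (intro has_wiener_integral_diff[OF brownian]) auto
  have R: "R \<in> lin_space M X T"
    using wiener_integral_in_lin_space[OF R_int] lin_space_eq by simp
  have R_meas [measurable]: "random_variable borel R"
    using R by (auto simp: lin_space_def dest: L2_measurable)
  have R_var: "expectation (\<lambda>\<omega>. (R \<omega>)\<^sup>2) = \<rho>"
    unfolding \<rho>_def by (rule wiener_integral_isometry[OF brownian R_int])
  have "\<rho> \<ge> 0" by (simp add: \<rho>_def)
  have uncorrelated: "expectation (\<lambda>\<omega>. R \<omega> * X s \<omega>) = 0" if s: "s \<in> D" for s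
  proof -
    have sT: "s \<in> {0..T}" using s D by blast
    have X_F: "X s \<in> borel_measurable F" unfolding F_def by (rule measurable_sigma_gen[OF s])
    have Xst: "integrable M (\<lambda>\<omega>. X s \<omega> * X t \<omega>)" by (intro L2_integrable_mult X_L2 sT t)
    have Xs_hat: "integrable M (\<lambda>\<omega>. X s \<omega> * Xhat \<omega>)" by (intro L2_integrable_mult X_L2 sT XhatL)
    \<comment> \<open>\<open>X s\<close> is F-measurable and can be taken inside the conditional
      expectation: the residual is orthogonal to the observations.\<close>
    have "(\<integral>\<omega>. X s \<omega> * Xhat \<omega> \<partial>M) = (\<integral>\<omega>. X s \<omega> * X t \<omega> \<partial>M)"
      unfolding Xhat_def F_def[symmetric]
      by (rule F.real_cond_exp_intg(2)[OF Xst X_F X_measurable[OF t]])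
    moreover have "(\<lambda>\<omega>. R \<omega> * X s \<omega>) = (\<lambda>\<omega>. X s \<omega> * X t \<omega> - X s \<omega> * Xhat \<omega>)"
      by (simp add: R_def fun_eq_iff algebra_simps)
    ultimately show ?thesis using Xst Xs_hat by simp
  qed
  have indep: "prob (A \<inter> (R -` B \<inter> space M)) = prob A * prob (R -` B \<inter> space M)"
    if "A \<in> sets F" "B \<in> sets borel" for A B
    using that unfolding F_def by (intro indep_of_uncorrelated[OF D R uncorrelated])
  have law: "distr M borel R = distr std_normal_distribution borel (\<lambda>z. z * sqrt \<rho>)"
    using R_meas _ \<open>\<rho> \<ge> 0\<close>
    by (rule distr_eq_scaled_std_normal) (simp only: lin_space_X_integral_iexp[OF R] R_var)
  have shift: "X t = (\<lambda>\<omega>. Xhat \<omega> + R \<omega>)" by (simp add: R_def fun_eq_iff)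
  have "AE \<omega> in M. integrable (distr M borel R) (\<lambda>r. h (Xhat \<omega> + r)) \<and>
    real_cond_exp M F (\<lambda>\<omega>. h (Xhat \<omega> + R \<omega>)) \<omega> = (\<integral>r. h (Xhat \<omega> + r) \<partial>distr M borel R)"
  proof (rule real_cond_exp_indep_shift[OF F R_meas _ h indep])
    show "Xhat \<in> borel_measurable F" by (simp add: Xhat_def F_def)
    show "integrable M (\<lambda>\<omega>. h (Xhat \<omega> + R \<omega>))" using int by (simp add: R_def)
  qed
  moreover have "integrable (distr M borel R) (\<lambda>r. h (v + r)) \<longleftrightarrow>
      integrable lborel (\<lambda>z. h (v + z * sqrt \<rho>) * std_normal_density z)" for v
    unfolding law by (subst integrable_distr_eq) (simp_all add: integrable_density mult.commute)
  moreover have "(\<integral>r. h (v + r) \<partial>distr M borel R) =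
      (\<integral>z. h (v + z * sqrt \<rho>) * std_normal_density z \<partial>lborel)" for v
    unfolding law by (subst integral_distr) (simp_all add: integral_density mult.commute)
  ultimately show ?thesis by (simp add: F_def R_def)
qed

end

text \<open>Integrability of \<open>Y t\<close> is what gives its conditional expectation a meaning.
  The conclusion includes integrability of the integrand, as otherwise the right-hand side could be
  the default value 0.\<close>

theorem theorem3p1:
  fixes M :: "'a measure" and T t :: real
    and X W Y :: "real \<Rightarrow> 'a \<Rightarrow> real"
    and K f :: "real \<Rightarrow> real \<Rightarrow> real"
    and n :: nat and tL tU :: "nat \<Rightarrow> real" and \<Delta> :: "real set"
    and ft :: "real \<Rightarrow> real" and Xhat :: "'a \<Rightarrow> real" and \<rho> :: real
  assumes "fredholm_gaussian_process M T X K W"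
    and "(\<lambda>(s, x). f s x) \<in> borel_measurable (restrict_space borel ({0..T} \<times> UNIV))"
    and "\<forall>s\<in>{0..T}. bij (f s)"
    and "Y = (\<lambda>s \<omega>. f s (X s \<omega>))"
    and "interval_system T n tL tU"
    and "\<Delta> = observed n tL tU"
    and "t \<in> {0..T} - \<Delta>"
    and "integrable M (Y t)"
    and "prediction_kernel M T X K W n tL tU t ft"
    and "Xhat = real_cond_exp M (sigma_gen M X \<Delta>) (X t)"
    and "\<rho> = (\<integral>u. (K t u - ft u)\<^sup>2 \<partial>lebesgue_on {0..T})"
  shows "AE \<omega> in M.
    integrable lborel (\<lambda>z. f t (Xhat \<omega> + z * sqrt \<rho>) * std_normal_density z) \<and>
    real_cond_exp M (sigma_gen M Y \<Delta>) (Y t) \<omega> =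
      (\<integral>z. f t (Xhat \<omega> + z * sqrt \<rho>) * std_normal_density z \<partial>lborel)"
proof -
  interpret fredholm_gaussian_process M T X K W by (rule assms(1))
  have D: "\<Delta> \<subseteq> {0..T}" using observed_subset[OF assms(5)] assms(6) by simp
  have t: "t \<in> {0..T}" using assms(7) by simp
  have f_meas: "f s \<in> borel_measurable borel" if "s \<in> {0..T}" for s
  proof -
    \<comment> \<open>A section of f is f composed with x -> (s, x), which maps into the strip on
      which f is measurable.\<close>
    have "Pair s \<in> measurable borel (restrict_space borel ({0..T} \<times> (UNIV :: real set)))"
      using that by (intro measurable_restrict_space2) auto
    from measurable_comp[OF this assms(2)] show ?thesis by (simp add: comp_def)
  qed
  have XD: "random_variable borel (X s)" if "s \<in> \<Delta>" for s
    using that D by (intro X_measurable) auto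
  have YD: "random_variable borel (Y s)" if "s \<in> \<Delta>" for s
    unfolding assms(4) using that D by (intro measurable_compose[OF XD f_meas]) auto
  have "AE \<omega> in M. real_cond_exp M (sigma_gen M X \<Delta>) (Y t) \<omega> =
      real_cond_exp M (sigma_gen M Y \<Delta>) (Y t) \<omega>"
  proof (rule real_cond_exp_eq_if_AE_eq_sets[OF _ _ _ _ assms(8)])
    show "subalgebra M (sigma_gen M X \<Delta>)" by (rule subalgebra_sigma_gen[OF XD])
    show "subalgebra M (sigma_gen M Y \<Delta>)" by (rule subalgebra_sigma_gen[OF YD])
    show "sets (sigma_gen M Y \<Delta>) \<subseteq> sets (sigma_gen M X \<Delta>)"
      unfolding assms(4) using D by (intro sets_sigma_gen_transform_subset f_meas) auto
    show "\<exists>A'\<in>sets (sigma_gen M Y \<Delta>). AE \<omega> in M. \<omega> \<in> A \<longleftrightarrow> \<omega> \<in> A'"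
      if "A \<in> sets (sigma_gen M X \<Delta>)" for A
      unfolding assms(4)
      by (rule ex_sigma_gen_transform[OF XD _ _ that])
        (use D assms(3) f_meas in \<open>auto dest: bij_is_inj\<close>)
  qed
  moreover have "AE \<omega> in M.
      integrable lborel (\<lambda>z. f t (Xhat \<omega> + z * sqrt \<rho>) * std_normal_density z) \<and>
      real_cond_exp M (sigma_gen M X \<Delta>) (Y t) \<omega> =
        (\<integral>z. f t (Xhat \<omega> + z * sqrt \<rho>) * std_normal_density z \<partial>lborel)"
    unfolding assms(10,11) assms(4)
  proof (rule real_cond_exp_transform[OF D t _ f_meas[OF t]])
    show "has_wiener_integral M T W ft (real_cond_exp M (sigma_gen M X \<Delta>) (X t))"
      using assms(9) by (simp add: prediction_kernel_def assms(6))
    show "integrable M (\<lambda>\<omega>. f t (X t \<omega>))" using assms(8) by (simp add: assms(4))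
  qed
  ultimately show ?thesis by eventually_elim simp
qed

end
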